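(* Let $\mathcal{A}$, $\mathcal{B}$ and $\mathcal{C}$ be pairwise disjoint subsets of $\mathcal{P}^{(1)}$. If $\mathcal{A}$ has a computable numbering, $\mathcal{B}$ and $\mathcal{C}$ have Friedberg numberings, and $\mathcal{B}$ is strongly dense in $\mathcal{A}\cup\mathcal{C}$, then there exists a uniformly c.e. sequence $\{\nu_i\}_{i\in\mathbb{N}}$ of pairwise incomparable Friedberg numberings of $\mathcal{A}\cup\mathcal{B}\cup\mathcal{C}$.
   Context: $\mathcal{P}^{(1)}$ denotes the set of all partial computable functions from $\mathbb{N}$ to $\mathbb{N}$. A numbering of a set $\mathcal{A}$ is a surjective map $\nu\colon\mathbb{N}\to\mathcal{A}$. A numbering $\nu$ is reducible to a numbering $\mu$, written $\nu\leq\mu$, if there is a total computable function $f\colon\mathbb{N}\to\mathbb{N}$ with $\nu=\mu\circ f$. Two numberings $\nu,\mu$ of the same set are incomparable if neither $\nu\leq\mu$ nor $\mu\leq\nu$; a sequence $\{\nu_i\}_{i\in\mathbb{N}}$ is pairwise incomparable if $\nu_i$ and $\nu_j$ are incomparable whenever $i\neq j$. A numbering $\nu$ of a subset of $\mathcal{P}^{(1)}$ is computable if the partial function $(i,x)\mapsto\nu(i)(x)$ from $\mathbb{N}^2$ to $\mathbb{N}$ is partial computable. A Friedberg numbering is an injective computable numbering. A sequence $\{\nu_i\}_{i\in\mathbb{N}}$ of numberings of a subset of $\mathcal{P}^{(1)}$ is uniformly c.e. if the partial function $(i,n,x)\mapsto\nu_i(n)(x)$ from $\mathbb{N}^3$ to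 $\mathbb{N}$ is partial computable. For $\mathcal{X},\mathcal{Y}\subseteq\mathcal{P}^{(1)}$, $\mathcal{Y}$ is strongly dense in $\mathcal{X}$ if every finite subfunction (restriction to a finite domain) of a member of $\mathcal{X}$ has infinitely many extensions in $\mathcal{Y}$. *)

theory Defs
  imports Main
begin

text \<open>
  Terms for the partial recursive functions. They carry no arity: \<open>recf_eval p\<close> maps argument
  lists to results, and the \<open>k\<close>-ary function of \<open>p\<close> is its restriction to lists of length \<open>k\<close>.
  The length of the argument list of a term fixes the length of the argument lists of all its
  subterms, and a mismatch (\<open>Succ\<close>, \<open>Prec\<close> on the empty list, \<open>Proj\<close> out of range) is
  divergence, so for each \<open>k\<close> this yields exactly the \<open>k\<close>-ary partial recursive functions.
\<close>

datatype recf =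
    Zero
  | Succ
  | Proj nat
  | Comp recf "recf list"
  | Prec recf recf
  | Mu recf

text \<open>
  Composition is strict. Unbounded search succeeds at \<open>z\<close> only if the searched function is
  defined and nonzero at every smaller argument.
\<close>

fun recf_eval :: "recf \<Rightarrow> nat list \<Rightarrow> nat option" where
  "recf_eval Zero xs = Some 0"
| "recf_eval Succ xs = (case xs of [] \<Rightarrow> None | x # _ \<Rightarrow> Some (Suc x))"
| "recf_eval (Proj i) xs = (if i < length xs then Some (xs ! i) else None)"
| "recf_eval (Comp p qs) xs =
    (let vs = map (\<lambda>q. recf_eval q xs) qs
     in if None \<in> set vs then None else recf_eval p (map the vs))"
| "recf_eval (Prec p q) xs =
    (case xs of
       [] \<Rightarrow> None
     | n # ys \<Rightarrow>
         rec_nat (recf_eval p ys)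
           (\<lambda>m r. case r of None \<Rightarrow> None | Some v \<Rightarrow> recf_eval q (m # v # ys)) n)"
| "recf_eval (Mu p) xs =
    (let found = (\<lambda>z. recf_eval p (z # xs) = Some 0 \<and>
                      (\<forall>y<z. \<exists>v. recf_eval p (y # xs) = Some v \<and> v \<noteq> 0))
     in if \<exists>z. found z then Some (LEAST z. found z) else None)"

definition partial_computable1 :: "(nat \<rightharpoonup> nat) \<Rightarrow> bool" where
  "partial_computable1 f \<longleftrightarrow> (\<exists>p. \<forall>x. recf_eval p [x] = f x)"

definition partial_computable2 :: "(nat \<Rightarrow> nat \<rightharpoonup> nat) \<Rightarrow> bool" where
  "partial_computable2 f \<longleftrightarrow> (\<exists>p. \<forall>i x. recf_eval p [i, x] = f i x)"

definition partial_computable3 :: "(nat \<Rightarrow> nat \<Rightarrow> nat \<rightharpoonup> nat) \<Rightarrow> bool" where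
  "partial_computable3 f \<longleftrightarrow> (\<exists>p. \<forall>i n x. recf_eval p [i, n, x] = f i n x)"

definition total_computable :: "(nat \<Rightarrow> nat) \<Rightarrow> bool" where
  "total_computable f \<longleftrightarrow> partial_computable1 (\<lambda>x. Some (f x))"

definition P1 :: "(nat \<rightharpoonup> nat) set" where
  "P1 = {f. partial_computable1 f}"

definition numbering :: "(nat \<Rightarrow> 'a) \<Rightarrow> 'a set \<Rightarrow> bool" where
  "numbering \<nu> A \<longleftrightarrow> range \<nu> = A"

definition reducible :: "(nat \<Rightarrow> 'a) \<Rightarrow> (nat \<Rightarrow> 'a) \<Rightarrow> bool" where
  "reducible \<nu> \<mu> \<longleftrightarrow> (\<exists>f. total_computable f \<and> \<nu> = \<mu> \<circ> f)"

definition incomparable :: "(nat \<Rightarrow> 'a) \<Rightarrow> (nat \<Rightarrow> 'a) \<Rightarrow> bool" where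
  "incomparable \<nu> \<mu> \<longleftrightarrow> \<not> reducible \<nu> \<mu> \<and> \<not> reducible \<mu> \<nu>"

definition pairwise_incomparable :: "(nat \<Rightarrow> nat \<Rightarrow> 'a) \<Rightarrow> bool" where
  "pairwise_incomparable \<nu> \<longleftrightarrow> (\<forall>i j. i \<noteq> j \<longrightarrow> incomparable (\<nu> i) (\<nu> j))"

definition computable_numbering :: "(nat \<Rightarrow> (nat \<rightharpoonup> nat)) \<Rightarrow> (nat \<rightharpoonup> nat) set \<Rightarrow> bool" where
  "computable_numbering \<nu> A \<longleftrightarrow> numbering \<nu> A \<and> partial_computable2 \<nu>"

definition friedberg_numbering :: "(nat \<Rightarrow> (nat \<rightharpoonup> nat)) \<Rightarrow> (nat \<rightharpoonup> nat) set \<Rightarrow> bool" where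
  "friedberg_numbering \<nu> A \<longleftrightarrow> computable_numbering \<nu> A \<and> inj \<nu>"

definition uniformly_ce :: "(nat \<Rightarrow> nat \<Rightarrow> (nat \<rightharpoonup> nat)) \<Rightarrow> bool" where
  "uniformly_ce \<nu> \<longleftrightarrow> partial_computable3 \<nu>"

definition strongly_dense_in :: "(nat \<rightharpoonup> nat) set \<Rightarrow> (nat \<rightharpoonup> nat) set \<Rightarrow> bool" where
  "strongly_dense_in Y X \<longleftrightarrow>
    (\<forall>f\<in>X. \<forall>D. finite D \<longrightarrow> infinite {g \<in> Y. f |` D \<subseteq>\<^sub>m g})"

end

theory Submission
  imports Defs "HOL-Library.Nat_Bijection"
begin

text \<open>
  Let \<open>\<alpha>\<close>, \<open>\<beta>\<close>, \<open>\<gamma>\<close> be the given numberings of \<open>A\<close>, \<open>B\<close>, \<open>C\<close>. The proof is Kummer's priority-free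
  construction of a Friedberg numbering, with the members of \<open>C\<close> used for diagonalization.

  One numbering. Every function of \<open>A\<close> and \<open>C\<close> is followed by slots, a slot being an index of the
  numbering under construction that copies the function as it is enumerated. A slot can be
  released: it has by then shown only a finite subfunction of what it follows, and by strong density
  infinitely many members of \<open>B\<close> extend this subfunction, so the slot can be turned into an unused
  \<open>\<beta> b\<close>, while a fresh slot takes over as follower. A slot for \<open>\<alpha> i\<close> is released when, at the stage
  reached, \<open>\<alpha> i\<close> looks equal to some \<open>\<alpha> j\<close> with \<open>j < i\<close> on the arguments below the slot's own
  threshold. As thresholds grow, this happens finitely often if \<open>i\<close> is the least index of \<open>\<alpha> i\<close>, and
  to every slot otherwise; so each member of \<open>A\<close> keeps exactly one slot (\<open>ex_follower_\<alpha>\<close>,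
  \<open>follower_\<alpha>_minimal\<close>). Steps at which no slot is released supply slots without any constraint, and
  these exhaust the remaining members of \<open>B\<close> (\<open>surj_assigned\<close>). As \<open>A\<close>, \<open>B\<close>, \<open>C\<close> are disjoint, the
  numbering is injective (\<open>inj_\<nu>\<close>) and it enumerates the union (\<open>range_\<nu>\<close>).

  Incomparability. Fix for the \<open>k\<close>-th numbering and the program \<open>e\<close> the witness \<open>\<gamma> c\<close> with
  \<open>c = pair k e\<close>. Its first slot \<open>a\<close> is the same number in all numberings. It is released in the \<open>k\<close>-th
  numbering only, and only when program \<open>e\<close> is seen to map \<open>a\<close> to \<open>a\<close>. If \<open>e\<close> computes a reduction
  \<open>f\<close> of \<open>\<nu> k\<close> to \<open>\<nu> j\<close> with \<open>k \<noteq> j\<close>, then \<open>f a = a\<close> is impossible because \<open>\<nu> k a\<close> is then in \<open>B\<close>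
  while \<open>\<nu> j a = \<gamma> c\<close>; and \<open>f a \<noteq> a\<close> is impossible because then \<open>\<nu> k a = \<gamma> c = \<nu> j a\<close> and \<open>\<nu> j\<close> is
  injective (\<open>not_reducible_\<nu>\<close>). Every requirement has a witness of its own and removes no slot of any
  other witness, so the requirements are met without injury.

  Computability. The construction asks only decidable questions about stagewise approximations of
  \<open>\<alpha>\<close>, \<open>\<beta>\<close>, \<open>\<gamma>\<close> and of all programs. These come from a universal machine: a small-step evaluator
  for \<open>recf\<close>, transported to codes, whose single step is a computable function
  (\<open>recf_eval_iff_value_within\<close>).
\<close>

section \<open>Computable functions on coded data\<close>

definition pair :: "nat \<Rightarrow> nat \<Rightarrow> nat" where
  "pair a b = prod_encode (a, b)"

definition pfst :: "nat \<Rightarrow> nat" where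
  "pfst n = fst (prod_decode n)"

definition psnd :: "nat \<Rightarrow> nat" where
  "psnd n = snd (prod_decode n)"

lemma pfst_pair [simp]: "pfst (pair a b) = a"
  and psnd_pair [simp]: "psnd (pair a b) = b"
  and pair_pfst_psnd [simp]: "pair (pfst n) (psnd n) = n"
  and pair_eq_iff [simp]: "pair a b = pair c d \<longleftrightarrow> a = c \<and> b = d"
  by (simp_all add: pair_def pfst_def psnd_def)

lemma le_pair_psnd: "b \<le> pair a b"
  unfolding pair_def by (rule le_prod_encode_2)

text \<open>
  The closure rules are stated for unary functions. Several arguments are passed as one nested pair, so that
  every closure rule below has the form \<open>computable (\<lambda>x. \<dots>)\<close> with \<open>x\<close> a whole environment and
  can be used as an introduction rule; a bound variable is handled by pairing it onto the environment.
\<close>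

abbreviation computable :: "(nat \<Rightarrow> nat) \<Rightarrow> bool" where
  "computable \<equiv> total_computable"

lemma computable_iff: "computable f \<longleftrightarrow> (\<exists>p. \<forall>x. recf_eval p [x] = Some (f x))"
  by (simp add: total_computable_def partial_computable1_def)

definition add_prog :: recf where
  "add_prog = Prec (Proj 0) (Comp Succ [Proj 1])"

definition pred_prog :: recf where
  "pred_prog = Prec Zero (Proj 0)"

definition rsub_prog :: recf where
  "rsub_prog = Prec (Proj 0) (Comp pred_prog [Proj 1])"

definition triangle_prog :: recf where
  "triangle_prog = Prec Zero (Comp Succ [Comp add_prog [Proj 0, Proj 1]])"

definition pair_prog :: recf where
  "pair_prog = Comp add_prog [Comp triangle_prog [Comp add_prog [Proj 0, Proj 1]], Proj 0]"

text \<open>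
  For \<open>n = prod_encode (a, b)\<close> this search finds the diagonal \<open>a + b\<close>, the least \<open>w\<close> with
  \<open>n < triangle (w + 1)\<close>. Inverting the pairing function is then a matter of subtraction.
\<close>

definition root_prog :: recf where
  "root_prog =
    Mu (Comp rsub_prog [Comp triangle_prog [Comp Succ [Proj 0]], Comp Succ [Proj 1]])"

definition pfst_prog :: recf where
  "pfst_prog = Comp rsub_prog [Comp triangle_prog [root_prog], Proj 0]"

definition psnd_prog :: recf where
  "psnd_prog = Comp rsub_prog [pfst_prog, root_prog]"

lemma add_prog [simp]: "recf_eval add_prog [a, b] = Some (a + b)"
  unfolding add_prog_def by (induction a) auto

lemma pred_prog [simp]: "recf_eval pred_prog [a] = Some (a - 1)"
  unfolding pred_prog_def by (induction a) auto

lemma rsub_prog [simp]: "recf_eval rsub_prog [a, b] = Some (b - a)"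
  unfolding rsub_prog_def by (induction a) auto

lemma triangle_prog [simp]: "recf_eval triangle_prog [a] = Some (triangle a)"
  unfolding triangle_prog_def by (induction a) auto

lemma pair_prog [simp]: "recf_eval pair_prog [a, b] = Some (pair a b)"
  by (simp add: pair_prog_def pair_def prod_encode_def)

lemma recf_eval_Mu_total:
  assumes total: "\<And>z. recf_eval p (z # xs) = Some (g z)"
  shows "recf_eval (Mu p) xs = (if \<exists>z. g z = 0 then Some (LEAST z. g z = 0) else None)"
proof (cases "\<exists>z. g z = 0")
  case True
  define l where "l = (LEAST z. g z = 0)"
  have l: "g l = 0"
    unfolding l_def using True by (rule LeastI_ex)
  have below: "g y \<noteq> 0" if "y < l" for y
    using that unfolding l_def by (rule not_less_Least)
  have "recf_eval p (z # xs) = Some 0 \<and>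
    (\<forall>y<z. \<exists>v. recf_eval p (y # xs) = Some v \<and> v \<noteq> 0) \<longleftrightarrow> z = l" for z
    unfolding total option.inject using l below by (metis linorder_neqE_nat)
  with True show ?thesis
    by (auto simp: Let_def l_def [symmetric] intro: Least_equality)
qed (simp add: total Let_def)

lemma triangle_mono: "a \<le> b \<Longrightarrow> triangle a \<le> triangle b"
  unfolding triangle_def by (intro div_le_mono mult_le_mono) auto

lemma triangle_root:
  "(LEAST w. Suc n - triangle (Suc w) = 0) = pfst n + psnd n"
proof -
  define a b where "a = pfst n" and "b = psnd n"
  have n: "n = triangle (a + b) + a"
    using pair_pfst_psnd [of n] by (simp add: a_def b_def pair_def prod_encode_def)
  have "(LEAST w. Suc n - triangle (Suc w) = 0) = a + b"
  proof (rule Least_equality)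
    show "Suc n - triangle (Suc (a + b)) = 0"
      by (simp add: n)
  next
    fix w assume "Suc n - triangle (Suc w) = 0"
    then have "n < triangle (Suc w)" by simp
    then have "\<not> Suc w \<le> a + b"
      using triangle_mono [of "Suc w" "a + b"] n by linarith
    then show "a + b \<le> w" by simp
  qed
  then show ?thesis by (simp add: a_def b_def)
qed

lemma root_prog [simp]: "recf_eval root_prog [n] = Some (pfst n + psnd n)"
proof -
  have "Suc n - triangle (Suc n) = 0"
    by simp
  then have "recf_eval root_prog [n] = Some (LEAST w. Suc n - triangle (Suc w) = 0)"
    unfolding root_prog_def by (subst recf_eval_Mu_total [where g = "\<lambda>w. Suc n - triangle (Suc w)"])
      (auto intro: exI [of _ n])
  then show ?thesis by (simp only: triangle_root)
qed

lemma pfst_prog [simp]: "recf_eval pfst_prog [n] = Some (pfst n)"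
proof -
  have "n - triangle (pfst n + psnd n) = pfst n"
    using pair_pfst_psnd [of n] unfolding pair_def prod_encode_def split by linarith
  then show ?thesis by (simp add: pfst_prog_def)
qed

lemma psnd_prog [simp]: "recf_eval psnd_prog [n] = Some (psnd n)"
  by (simp add: psnd_prog_def)

lemma computable_id: "computable (\<lambda>x. x)"
  unfolding computable_iff by (rule exI [of _ "Proj 0"]) simp

lemma computable_compose: "computable f \<Longrightarrow> computable g \<Longrightarrow> computable (\<lambda>x. f (g x))"
  unfolding computable_iff
proof (elim exE)
  fix p q assume "\<forall>x. recf_eval p [x] = Some (f x)" "\<forall>x. recf_eval q [x] = Some (g x)"
  then show "\<exists>p. \<forall>x. recf_eval p [x] = Some (f (g x))"
    by (intro exI [of _ "Comp p [q]"]) simp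
qed

lemma computable_Suc: "computable f \<Longrightarrow> computable (\<lambda>x. Suc (f x))"
  by (rule computable_compose [of Suc]) (auto simp: computable_iff intro!: exI [of _ Succ])

lemma computable_const: "computable (\<lambda>x. c)"
proof (induction c)
  case 0
  show ?case unfolding computable_iff by (rule exI [of _ Zero]) simp
qed (rule computable_Suc)

lemma computable_pfst: "computable f \<Longrightarrow> computable (\<lambda>x. pfst (f x))"
  by (rule computable_compose [of pfst]) (auto simp: computable_iff intro!: exI [of _ pfst_prog])

lemma computable_psnd: "computable f \<Longrightarrow> computable (\<lambda>x. psnd (f x))"
  by (rule computable_compose [of psnd]) (auto simp: computable_iff intro!: exI [of _ psnd_prog])

lemma computable_binary:
  assumes "\<And>a b. recf_eval r [a, b] = Some (h a b)" and "computable f" and "computable g"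
  shows "computable (\<lambda>x. h (f x) (g x))"
proof -
  obtain p q where "\<And>x. recf_eval p [x] = Some (f x)" "\<And>x. recf_eval q [x] = Some (g x)"
    using assms(2,3) unfolding computable_iff by blast
  then show ?thesis
    unfolding computable_iff using assms(1) by (intro exI [of _ "Comp r [p, q]"]) simp
qed

lemma computable_pair: "computable f \<Longrightarrow> computable g \<Longrightarrow> computable (\<lambda>x. pair (f x) (g x))"
  by (rule computable_binary [of pair_prog]) auto

lemma computable_add: "computable f \<Longrightarrow> computable g \<Longrightarrow> computable (\<lambda>x. f x + g x)"
  by (rule computable_binary [of add_prog]) auto

lemma computable_diff: "computable f \<Longrightarrow> computable g \<Longrightarrow> computable (\<lambda>x. f x - g x)"
  using computable_binary [of rsub_prog "\<lambda>a b. b - a" g f] by auto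

text \<open>
  These rules let the computability of a curried function be proved once, for projections of the
  environment, and then be used for arbitrary computable arguments. This is needed for functions
  whose definition binds variables: under the binder the environment changes, and arguments that are
  merely assumed to be computable would have to be composed with a projection.
\<close>

lemma computable_compose2:
  assumes "computable (\<lambda>z. h (pfst z) (psnd z))" and "computable f" and "computable g"
  shows "computable (\<lambda>x. h (f x) (g x))"
  using computable_compose [OF assms(1) computable_pair [OF assms(2,3)]] by simp

lemma computable_compose3:
  assumes "computable (\<lambda>z. h (pfst z) (pfst (psnd z)) (psnd (psnd z)))"
    and "computable f" and "computable g" and "computable k"
  shows "computable (\<lambda>x. h (f x) (g x) (k x))"
  using computable_compose [OF assms(1) computable_pair [OF assms(2)
      computable_pair [OF assms(3,4)]]] by simp

lemma computable_compose4:
  assumes "computable (\<lambda>z. h (pfst z) (pfst (psnd z)) (pfst (psnd (psnd z))) (psnd (psnd (psnd z))))"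
    and "computable f" and "computable g" and "computable k" and "computable l"
  shows "computable (\<lambda>x. h (f x) (g x) (k x) (l x))"
  using computable_compose [OF assms(1) computable_pair [OF assms(2)
      computable_pair [OF assms(3) computable_pair [OF assms(4,5)]]]] by simp

lemma computable_rec_nat:
  assumes "computable (\<lambda>z. F (pfst z) (pfst (psnd z)) (psnd (psnd z)))"
    and "computable a" and "computable n"
  shows "computable (\<lambda>x. rec_nat (a x) (\<lambda>m r. F x m r) (n x))"
proof -
  obtain pF pa pn where p:
    "\<And>z. recf_eval pF [z] = Some (F (pfst z) (pfst (psnd z)) (psnd (psnd z)))"
    "\<And>x. recf_eval pa [x] = Some (a x)" "\<And>x. recf_eval pn [x] = Some (n x)"
    using assms unfolding computable_iff by blast
  define q where "q = Comp pF [Comp pair_prog [Proj 2, Comp pair_prog [Proj 0, Proj 1]]]"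
  have q: "recf_eval q [m, r, x] = Some (F x m r)" for m r x
    by (simp add: q_def p)
  have rec: "recf_eval (Prec pa q) [i, x] = Some (rec_nat (a x) (\<lambda>m r. F x m r) i)" for i x
  proof -
    have "rec_nat (recf_eval pa [x]) (\<lambda>m r. case r of None \<Rightarrow> None
        | Some v \<Rightarrow> recf_eval q (m # v # [x])) i = Some (rec_nat (a x) (\<lambda>m r. F x m r) i)"
      by (induction i) (simp_all add: p q)
    then show ?thesis by simp
  qed
  show ?thesis
    unfolding computable_iff
    by (intro exI [of _ "Comp (Prec pa q) [pn, Proj 0]"]) (simp add: rec p del: recf_eval.simps(5))
qed

lemma funpow_eq_rec_nat: "(f ^^ n) a = rec_nat a (\<lambda>_. f) n"
  by (induction n) simp_all

lemma computable_funpow: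
  assumes "computable (\<lambda>z. F (pfst z) (psnd z))" and "computable a" and "computable n"
  shows "computable (\<lambda>x. (F x ^^ n x) (a x))"
proof -
  have "computable (\<lambda>z. F (pfst z) (psnd (psnd z)))"
    by (rule computable_compose2 [of F, OF assms(1)]) (intro computable_pfst computable_psnd computable_id)+
  from computable_rec_nat [of "\<lambda>x m r. F x r", OF this assms(2,3)]
  show ?thesis
    by (simp only: funpow_eq_rec_nat)
qed

definition decidable :: "(nat \<Rightarrow> bool) \<Rightarrow> bool" where
  "decidable P \<longleftrightarrow> computable (\<lambda>x. of_bool (P x))"

lemma computable_if:
  assumes "decidable P" and "computable f" and "computable g"
  shows "computable (\<lambda>x. if P x then f x else g x)"
proof -
  have "computable (\<lambda>x. rec_nat (g x) (\<lambda>_ _. f x) (of_bool (P x)))"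
    using assms(1) unfolding decidable_def
    by (intro computable_rec_nat assms(3)
        computable_compose [OF assms(2) computable_pfst [OF computable_id]])
  moreover have "rec_nat (g x) (\<lambda>_ _. f x) (of_bool (P x)) = (if P x then f x else g x)" for x
    by simp
  ultimately show ?thesis by simp
qed

lemma decidable_zero: "computable f \<Longrightarrow> decidable (\<lambda>x. f x = 0)"
proof -
  assume "computable f"
  then have "computable (\<lambda>x. 1 - f x)"
    by (intro computable_diff computable_const)
  moreover have "1 - f x = of_bool (f x = 0)" for x
    by simp
  ultimately show ?thesis by (simp add: decidable_def)
qed

lemma decidable_not: "decidable P \<Longrightarrow> decidable (\<lambda>x. \<not> P x)"
  using decidable_zero [of "\<lambda>x. of_bool (P x)"] unfolding decidable_def by simp

lemma decidable_conj: "decidable P \<Longrightarrow> decidable Q \<Longrightarrow> decidable (\<lambda>x. P x \<and> Q x)"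
proof -
  assume "decidable P" "decidable Q"
  then have "computable (\<lambda>x. if P x then of_bool (Q x) else 0)"
    by (intro computable_if computable_const) (simp_all add: decidable_def)
  moreover have "(if P x then of_bool (Q x) else 0) = (of_bool (P x \<and> Q x) :: nat)" for x
    by simp
  ultimately show ?thesis by (simp add: decidable_def)
qed

lemma decidable_disj: "decidable P \<Longrightarrow> decidable Q \<Longrightarrow> decidable (\<lambda>x. P x \<or> Q x)"
proof -
  assume "decidable P" "decidable Q"
  then have "decidable (\<lambda>x. \<not> (\<not> P x \<and> \<not> Q x))"
    by (intro decidable_not decidable_conj)
  then show ?thesis by (simp only: de_Morgan_conj not_not)
qed

lemma decidable_imp: "decidable P \<Longrightarrow> decidable Q \<Longrightarrow> decidable (\<lambda>x. P x \<longrightarrow> Q x)"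
  unfolding imp_conv_disj by (intro decidable_disj decidable_not)

lemma decidable_eq: "computable f \<Longrightarrow> computable g \<Longrightarrow> decidable (\<lambda>x. f x = g x)"
proof -
  assume "computable f" "computable g"
  then have "decidable (\<lambda>x. (f x - g x) + (g x - f x) = 0)"
    by (intro decidable_zero computable_add computable_diff)
  moreover have "(f x - g x) + (g x - f x) = 0 \<longleftrightarrow> f x = g x" for x
    by arith
  ultimately show ?thesis by (simp only:)
qed

lemma decidable_less: "computable f \<Longrightarrow> computable g \<Longrightarrow> decidable (\<lambda>x. f x < g x)"
  using decidable_zero [of "\<lambda>x. Suc (f x) - g x"]
  by (simp add: computable_Suc computable_diff Suc_le_eq)

lemma decidable_bex:
  assumes "decidable (\<lambda>z. P (pfst z) (psnd z))" and "computable n"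
  shows "decidable (\<lambda>x. \<exists>i<n x. P x i)"
proof -
  have P: "decidable (\<lambda>z. P (pfst z) (pfst (psnd z)))"
    using computable_compose2 [of "\<lambda>a b. of_bool (P a b)" pfst "\<lambda>z. pfst (psnd z)"] assms(1)
    by (simp add: decidable_def computable_pfst computable_psnd computable_id)
  have "computable (\<lambda>x. rec_nat 0 (\<lambda>m r. if P x m then 1 else r) (n x))"
    by (intro computable_rec_nat computable_if P assms(2) computable_const computable_psnd
        computable_id)
  moreover have "rec_nat 0 (\<lambda>m r. if P x m then 1 else r) j = (of_bool (\<exists>i<j. P x i) :: nat)" for x j
    by (induction j) (auto simp: less_Suc_eq)
  ultimately show ?thesis by (simp add: decidable_def)
qed

lemma decidable_ball:
  assumes "decidable (\<lambda>z. P (pfst z) (psnd z))" and "computable n"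
  shows "decidable (\<lambda>x. \<forall>i<n x. P x i)"
  using decidable_not [OF decidable_bex [of "\<lambda>x i. \<not> P x i", OF decidable_not [OF assms(1)] assms(2)]]
  by simp

text \<open>
  Totality of the search is a hypothesis, because \<open>LEAST\<close> of an empty predicate is an
  unspecified number, whereas the search diverges there.
\<close>

lemma computable_Least:
  assumes "decidable (\<lambda>z. P (pfst z) (psnd z))" and "\<And>x. \<exists>y. P x y"
  shows "computable (\<lambda>x. LEAST y. P x y)"
proof -
  obtain p where p: "\<And>z. recf_eval p [z] = Some (of_bool (\<not> P (pfst z) (psnd z)))"
    using decidable_not [OF assms(1)] unfolding decidable_def computable_iff by blast
  define q where "q = Comp p [Comp pair_prog [Proj 1, Proj 0]]"
  have "recf_eval q [y, x] = Some (of_bool (\<not> P x y))" for y x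
    by (simp add: q_def p)
  from recf_eval_Mu_total [OF this] assms(2) have "recf_eval (Mu q) [x] = Some (LEAST y. P x y)" for x
    by simp
  then show ?thesis
    unfolding computable_iff by (intro exI [of _ "Mu q"]) simp
qed

lemmas computable_intros =
  computable_id computable_const computable_Suc computable_pfst computable_psnd computable_pair
  computable_add computable_diff computable_rec_nat computable_funpow computable_if
  decidable_not decidable_conj decidable_disj decidable_imp decidable_eq decidable_less
  decidable_bex decidable_ball

section \<open>A universal machine\<close>

text \<open>
  A state evaluates a term, works through the argument terms of a composition, or returns a value to
  a stack of suspended computations. The point of such a machine is that one step is not recursive:
  on codes it is a case distinction built from pairing and projections. \<open>Prec_Frame q ys m n\<close> has
  \<open>n\<close> rounds of the recursion left, the next one with counter \<open>m\<close>.
\<close>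

datatype frame =
    Arg_Frame recf "recf list" "nat list" "nat list"
  | Prec_Frame recf "nat list" nat nat
  | Mu_Frame recf "nat list" nat

datatype state =
    Eval recf "nat list" "frame list"
  | Args recf "recf list" "nat list" "nat list" "frame list"
  | Ret nat "frame list"
  | Stuck

text \<open>
  Argument terms are processed from the last to the first, since values are pushed onto the front of
  the accumulator. \<open>Ret v []\<close> is a fixed point, so that a finished run stays finished.
\<close>

fun step :: "state \<Rightarrow> state" where
  "step (Eval Zero xs K) = Ret 0 K"
| "step (Eval Succ [] K) = Stuck"
| "step (Eval Succ (x # xs) K) = Ret (Suc x) K"
| "step (Eval (Proj i) [] K) = Stuck"
| "step (Eval (Proj 0) (x # xs) K) = Ret x K"
| "step (Eval (Proj (Suc i)) (x # xs) K) = Eval (Proj i) xs K"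
| "step (Eval (Comp p qs) xs K) = Args p (rev qs) xs [] K"
| "step (Eval (Prec p q) [] K) = Stuck"
| "step (Eval (Prec p q) (n # ys) K) = Eval p ys (Prec_Frame q ys 0 n # K)"
| "step (Eval (Mu p) xs K) = Eval p (0 # xs) (Mu_Frame p xs 0 # K)"
| "step (Args p [] xs vs K) = Eval p vs K"
| "step (Args p (q # qs) xs vs K) = Eval q xs (Arg_Frame p qs xs vs # K)"
| "step (Ret v []) = Ret v []"
| "step (Ret v (Arg_Frame p qs xs vs # K)) = Args p qs xs (v # vs) K"
| "step (Ret v (Prec_Frame q ys m 0 # K)) = Ret v K"
| "step (Ret v (Prec_Frame q ys m (Suc n) # K)) =
    Eval q (m # v # ys) (Prec_Frame q ys (Suc m) n # K)"
| "step (Ret v (Mu_Frame p xs z # K)) =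
    (if v = 0 then Ret z K else Eval p (Suc z # xs) (Mu_Frame p xs (Suc z) # K))"
| "step Stuck = Stuck"

text \<open>
  The denotation of a state is the value that the whole computation, including all suspended frames,
  has according to \<open>recf_eval\<close>. It does not change in a step (\<open>outcome_step\<close>), which yields
  soundness of the machine without any induction on runs through subterms. The functions before
  \<open>outcome\<close> are the denotations of partially executed compositions, recursions and searches.
\<close>

fun eval_args :: "recf list \<Rightarrow> nat list \<Rightarrow> nat list \<Rightarrow> nat list option" where
  "eval_args [] xs vs = Some vs"
| "eval_args (q # qs) xs vs = Option.bind (recf_eval q xs) (\<lambda>v. eval_args qs xs (v # vs))"

fun prec_from :: "recf \<Rightarrow> nat list \<Rightarrow> nat \<Rightarrow> nat \<Rightarrow> nat \<Rightarrow> nat option" where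
  "prec_from q ys m 0 v = Some v"
| "prec_from q ys m (Suc n) v = Option.bind (recf_eval q (m # v # ys)) (prec_from q ys (Suc m) n)"

definition first_zero :: "recf \<Rightarrow> nat list \<Rightarrow> nat \<Rightarrow> nat \<Rightarrow> bool" where
  "first_zero p xs z y \<longleftrightarrow> z \<le> y \<and> recf_eval p (y # xs) = Some 0 \<and>
    (\<forall>w. z \<le> w \<and> w < y \<longrightarrow> (\<exists>v. recf_eval p (w # xs) = Some v \<and> v \<noteq> 0))"

definition mu_from :: "recf \<Rightarrow> nat list \<Rightarrow> nat \<Rightarrow> nat option" where
  "mu_from p xs z = (if \<exists>y. first_zero p xs z y then Some (LEAST y. first_zero p xs z y) else None)"

fun resume :: "frame list \<Rightarrow> nat \<Rightarrow> nat option" where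
  "resume [] v = Some v"
| "resume (Arg_Frame p qs xs vs # K) v =
    Option.bind (Option.bind (eval_args qs xs (v # vs)) (recf_eval p)) (resume K)"
| "resume (Prec_Frame q ys m n # K) v = Option.bind (prec_from q ys m n v) (resume K)"
| "resume (Mu_Frame p xs z # K) v =
    (if v = 0 then resume K z else Option.bind (mu_from p xs (Suc z)) (resume K))"

fun outcome :: "state \<Rightarrow> nat option" where
  "outcome (Eval p xs K) = Option.bind (recf_eval p xs) (resume K)"
| "outcome (Args p qs xs vs K) =
    Option.bind (Option.bind (eval_args qs xs vs) (recf_eval p)) (resume K)"
| "outcome (Ret v K) = resume K v"
| "outcome Stuck = None"

lemma eval_args_append:
  "eval_args (qs @ rs) xs vs = Option.bind (eval_args qs xs vs) (eval_args rs xs)"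
  by (induction qs arbitrary: vs) (auto split: bind_split)

lemma eval_args_rev:
  "eval_args (rev qs) xs [] =
    (let vs = map (\<lambda>q. recf_eval q xs) qs in if None \<in> set vs then None else Some (map the vs))"
proof (induction qs)
  case (Cons q qs)
  then show ?case
    by (cases "recf_eval q xs") (auto simp: eval_args_append Let_def)
qed simp

lemma recf_eval_Comp:
  "recf_eval (Comp p qs) xs = Option.bind (eval_args (rev qs) xs []) (recf_eval p)"
  by (simp add: eval_args_rev Let_def)

lemma prec_from_Suc:
  "prec_from q ys m (Suc n) v =
    Option.bind (prec_from q ys m n v) (\<lambda>w. recf_eval q ((m + n) # w # ys))"
proof (induction n arbitrary: m v)
  case (Suc n)
  have "prec_from q ys m (Suc (Suc n)) v =
      Option.bind (recf_eval q (m # v # ys)) (\<lambda>u. prec_from q ys (Suc m) (Suc n) u)"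
    by (rule prec_from.simps)
  also have "\<dots> = Option.bind (recf_eval q (m # v # ys))
      (\<lambda>u. Option.bind (prec_from q ys (Suc m) n u) (\<lambda>w. recf_eval q ((m + Suc n) # w # ys)))"
    unfolding Suc.IH by simp
  also have "\<dots> = Option.bind (prec_from q ys m (Suc n) v) (\<lambda>w. recf_eval q ((m + Suc n) # w # ys))"
    by simp
  finally show ?case .
next
  case 0
  show ?case by (cases "recf_eval q (m # v # ys)") simp_all
qed

lemma recf_eval_Prec:
  "recf_eval (Prec p q) (n # ys) = Option.bind (recf_eval p ys) (prec_from q ys 0 n)"
proof (induction n)
  case (Suc n)
  have "recf_eval (Prec p q) (Suc n # ys) =
      Option.bind (recf_eval (Prec p q) (n # ys)) (\<lambda>v. recf_eval q (n # v # ys))"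
    by (simp split: option.split bind_split)
  also have "\<dots> = Option.bind (recf_eval p ys) (prec_from q ys 0 (Suc n))"
    unfolding Suc.IH prec_from_Suc by (cases "recf_eval p ys") simp_all
  finally show ?case .
next
  case 0
  show ?case by (cases "recf_eval p ys") simp_all
qed

lemma first_zero_unfold:
  "first_zero p xs z y \<longleftrightarrow>
    (case recf_eval p (z # xs) of None \<Rightarrow> False
      | Some v \<Rightarrow> if v = 0 then y = z else first_zero p xs (Suc z) y)"
proof (cases "recf_eval p (z # xs)")
  case None
  have False if "first_zero p xs z y"
  proof (cases "y = z")
    case True
    with that None show False by (simp add: first_zero_def)
  next
    case False
    with that have "z \<le> z \<and> z < y" by (simp add: first_zero_def)
    with that None show False unfolding first_zero_def by (metis option.distinct(1))
  qed
  with None show ?thesis by auto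
next
  case (Some v)
  show ?thesis
  proof (cases "v = 0")
    case True
    have "y = z" if "first_zero p xs z y"
    proof (rule ccontr)
      assume "y \<noteq> z"
      with that have "z \<le> z \<and> z < y" by (simp add: first_zero_def)
      with that Some True show False unfolding first_zero_def by (metis option.inject)
    qed
    with Some True show ?thesis by (auto simp: first_zero_def)
  next
    case False
    have "first_zero p xs z y \<longleftrightarrow> first_zero p xs (Suc z) y"
    proof
      assume "first_zero p xs z y"
      moreover from this Some False have "y \<noteq> z" by (auto simp: first_zero_def)
      ultimately show "first_zero p xs (Suc z) y" by (simp add: first_zero_def)
    next
      assume fz: "first_zero p xs (Suc z) y"
      have "\<exists>v. recf_eval p (w # xs) = Some v \<and> v \<noteq> 0" if "z \<le> w" "w < y" for w
        using that fz Some False by (cases "w = z") (simp_all add: first_zero_def)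
      with fz show "first_zero p xs z y" by (simp add: first_zero_def)
    qed
    with Some False show ?thesis by simp
  qed
qed

lemma mu_from_unfold:
  "mu_from p xs z = Option.bind (recf_eval p (z # xs)) (\<lambda>v. if v = 0 then Some z else mu_from p xs (Suc z))"
proof (cases "recf_eval p (z # xs)")
  case None
  then show ?thesis by (simp add: mu_from_def first_zero_unfold [of p xs z])
next
  case (Some v)
  show ?thesis
  proof (cases "v = 0")
    case True
    then have "first_zero p xs z = (\<lambda>y. y = z)"
      using Some by (intro ext) (simp add: first_zero_unfold [of p xs z])
    with Some True show ?thesis by (simp add: mu_from_def Least_equality)
  next
    case False
    then have "first_zero p xs z = first_zero p xs (Suc z)"
      using Some by (intro ext) (simp add: first_zero_unfold [of p xs z])
    with Some False show ?thesis by (simp add: mu_from_def)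
  qed
qed

lemma recf_eval_Mu: "recf_eval (Mu p) xs = mu_from p xs 0"
  by (simp add: mu_from_def first_zero_def Let_def)

lemma outcome_step: "outcome (step st) = outcome st"
proof (cases st rule: step.cases)
  case (7 p qs xs K)
  then show ?thesis by (simp del: recf_eval.simps add: recf_eval_Comp)
next
  case (9 p q n ys K)
  then show ?thesis
    by (cases "recf_eval p ys") (simp_all del: recf_eval.simps add: recf_eval_Prec)
next
  case (10 p xs K)
  then show ?thesis
    by (cases "recf_eval p (0 # xs)")
      (simp_all del: recf_eval.simps add: recf_eval_Mu mu_from_unfold [of p xs 0])
next
  case (12 p q qs xs vs K)
  then show ?thesis by (cases "recf_eval q xs") simp_all
next
  case (16 v q ys m n K)
  then show ?thesis by (cases "recf_eval q (m # v # ys)") simp_all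
next
  case (17 v p xs z K)
  then show ?thesis
    by (cases "recf_eval p (Suc z # xs)") (simp_all add: mu_from_unfold [of p xs "Suc z"])
qed simp_all

lemma outcome_funpow_step: "outcome ((step ^^ n) st) = outcome st"
  by (induction n) (simp_all add: outcome_step)

text \<open>
  For the converse, the machine must reach every value of \<open>recf_eval\<close>. The stack is arbitrary here,
  because subterms are evaluated on top of the frames of the enclosing term.
\<close>

definition reaches :: "state \<Rightarrow> state \<Rightarrow> bool" where
  "reaches st st' \<longleftrightarrow> (\<exists>n. (step ^^ n) st = st')"

lemma reaches_refl: "reaches st st"
  unfolding reaches_def by (rule exI [of _ 0]) simp

lemma reaches_trans: "reaches a b \<Longrightarrow> reaches b c \<Longrightarrow> reaches a c"
  unfolding reaches_def by (metis comp_apply funpow_add)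

lemma reaches_step: "reaches (step a) b \<Longrightarrow> reaches a b"
  by (rule reaches_trans [of a "step a"]) (auto simp: reaches_def intro: exI [of _ 1])

lemma reaches_Args:
  assumes "\<And>q v K. q \<in> set qs \<Longrightarrow> recf_eval q xs = Some v \<Longrightarrow> reaches (Eval q xs K) (Ret v K)"
    and "eval_args qs xs vs = Some us"
  shows "reaches (Args p qs xs vs K) (Eval p us K)"
  using assms
proof (induction qs arbitrary: vs)
  case Nil
  then show ?case by - (rule reaches_step, simp add: reaches_refl)
next
  case (Cons q qs)
  then obtain v where v: "recf_eval q xs = Some v" "eval_args qs xs (v # vs) = Some us"
    by (auto simp: bind_eq_Some_conv)
  have "reaches (Eval q xs (Arg_Frame p qs xs vs # K)) (Ret v (Arg_Frame p qs xs vs # K))"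
    using Cons.prems(1) v(1) by simp
  moreover have "reaches (Ret v (Arg_Frame p qs xs vs # K)) (Eval p us K)"
    using Cons.IH [OF Cons.prems(1) v(2)] by - (rule reaches_step, simp)
  ultimately show ?case
    by - (rule reaches_step, simp, rule reaches_trans)
qed

lemma reaches_Prec:
  assumes "\<And>xs v K. recf_eval q xs = Some v \<Longrightarrow> reaches (Eval q xs K) (Ret v K)"
    and "prec_from q ys m n v = Some w"
  shows "reaches (Ret v (Prec_Frame q ys m n # K)) (Ret w K)"
  using assms(2)
proof (induction n arbitrary: m v)
  case 0
  then show ?case by - (rule reaches_step, simp add: reaches_refl)
next
  case (Suc n)
  then obtain u where u: "recf_eval q (m # v # ys) = Some u" "prec_from q ys (Suc m) n u = Some w"
    by (auto simp: bind_eq_Some_conv)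
  show ?case
    by (rule reaches_step, simp) (rule reaches_trans [OF assms(1) [OF u(1)] Suc.IH [OF u(2)]])
qed

text \<open>
  All failing candidates of the search are defined and nonzero, so the search loop gets through
  each of them and arrives at the first zero.
\<close>

lemma reaches_Mu:
  assumes "\<And>xs v K. recf_eval p xs = Some v \<Longrightarrow> reaches (Eval p xs K) (Ret v K)"
    and "recf_eval p (z # xs) = Some 0"
    and "\<And>y. y < z \<Longrightarrow> \<exists>v. recf_eval p (y # xs) = Some v \<and> v \<noteq> 0"
  shows "reaches (Eval (Mu p) xs K) (Ret z K)"
proof -
  have "reaches (Eval (Mu p) xs K) (Eval p (y # xs) (Mu_Frame p xs y # K))" if "y \<le> z" for y
    using that
  proof (induction y)
    case 0
    show ?case by - (rule reaches_step, simp add: reaches_refl)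
  next
    case (Suc y)
    then obtain v where v: "recf_eval p (y # xs) = Some v" "v \<noteq> 0"
      using assms(3) by (metis Suc_le_lessD)
    have "reaches (Ret v (Mu_Frame p xs y # K)) (Eval p (Suc y # xs) (Mu_Frame p xs (Suc y) # K))"
      using v(2) by - (rule reaches_step [of "Ret _ _"], simp add: reaches_refl)
    moreover have "reaches (Eval (Mu p) xs K) (Eval p (y # xs) (Mu_Frame p xs y # K))"
      using Suc by simp
    ultimately show ?case
      using assms(1) [OF v(1)] by (blast intro: reaches_trans)
  qed
  moreover have "reaches (Ret 0 (Mu_Frame p xs z # K)) (Ret z K)"
    by - (rule reaches_step, simp add: reaches_refl)
  ultimately show ?thesis
    using assms(1) [OF assms(2)] by (blast intro: reaches_trans)
qed

lemma reaches_Proj: "i < length xs \<Longrightarrow> reaches (Eval (Proj i) xs K) (Ret (xs ! i) K)"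
proof (induction i arbitrary: xs)
  case 0
  then obtain x ys where "xs = x # ys" by (cases xs) auto
  then show ?case by - (rule reaches_step, simp add: reaches_refl)
next
  case (Suc i)
  then obtain x ys where "xs = x # ys" by (cases xs) auto
  with Suc show ?case by - (rule reaches_step, simp)
qed

lemma reaches_value: "recf_eval p xs = Some v \<Longrightarrow> reaches (Eval p xs K) (Ret v K)"
proof (induction p arbitrary: xs v K)
  case Zero
  then show ?case by - (rule reaches_step [of "Eval _ _ _"], simp add: reaches_refl)
next
  case Succ
  then obtain x ys where "xs = x # ys" "v = Suc x" by (cases xs) auto
  then show ?case by - (rule reaches_step, simp add: reaches_refl)
next
  case (Proj i)
  then show ?case using reaches_Proj by (auto split: if_splits)
next
  case (Comp p qs)
  then obtain us where us: "eval_args (rev qs) xs [] = Some us" "recf_eval p us = Some v"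
    unfolding recf_eval_Comp by (auto simp: bind_eq_Some_conv)
  have "reaches (Args p (rev qs) xs [] K) (Eval p us K)"
    using Comp.IH(2) us(1) by (intro reaches_Args) auto
  then have "reaches (Args p (rev qs) xs [] K) (Ret v K)"
    using Comp.IH(1) [OF us(2)] by (rule reaches_trans)
  then show ?case by - (rule reaches_step [of "Eval _ _ _"], simp)
next
  case (Prec p q)
  then obtain n ys where xs: "xs = n # ys"
    by (cases xs) auto
  with Prec.prems obtain u where u: "recf_eval p ys = Some u" "prec_from q ys 0 n u = Some v"
    unfolding xs recf_eval_Prec by (auto simp: bind_eq_Some_conv)
  have "reaches (Eval p ys (Prec_Frame q ys 0 n # K)) (Ret v K)"
    by (rule reaches_trans [OF Prec.IH(1) [OF u(1)] reaches_Prec [OF Prec.IH(2) u(2)]])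
  then show ?case unfolding xs by - (rule reaches_step [of "Eval _ _ _"], simp)
next
  case (Mu p)
  then have "\<exists>z. first_zero p xs 0 z" and v: "v = (LEAST z. first_zero p xs 0 z)"
    unfolding recf_eval_Mu mu_from_def by (auto split: if_splits)
  then have "first_zero p xs 0 v"
    by (auto intro: LeastI)
  then show ?case
    by (intro reaches_Mu Mu.IH) (auto simp: first_zero_def)
qed

lemma funpow_step_halted: "(step ^^ n) (Ret v []) = Ret v []"
  by (induction n) simp_all

lemma recf_eval_iff_halts:
  "recf_eval p xs = Some v \<longleftrightarrow> (\<exists>n. (step ^^ n) (Eval p xs []) = Ret v [])"
  by (metis (no_types) bind.bind_lunit bind_rzero reaches_value reaches_def outcome_funpow_step
      outcome.simps(1,3) resume.simps(1) bind_eq_Some_conv option.inject)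

text \<open>
  A constructor becomes a numeric tag paired with the codes of its arguments. Thus \<open>pfst\<close> reads off
  the constructor, and the coded step below needs no decoding other than projections.
\<close>

primrec list_code :: "nat list \<Rightarrow> nat" where
  "list_code [] = pair 0 0"
| "list_code (x # xs) = pair 1 (pair x (list_code xs))"

text \<open>
  The arguments of a composition are stored in reverse, which is the order in which the machine
  consumes them.
\<close>

fun recf_code :: "recf \<Rightarrow> nat" where
  "recf_code Zero = pair 0 0"
| "recf_code Succ = pair 1 0"
| "recf_code (Proj i) = pair 2 i"
| "recf_code (Comp p qs) = pair 3 (pair (recf_code p) (list_code (rev (map recf_code qs))))"
| "recf_code (Prec p q) = pair 4 (pair (recf_code p) (recf_code q))"
| "recf_code (Mu p) = pair 5 (recf_code p)"

fun frame_code :: "frame \<Rightarrow> nat" where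
  "frame_code (Arg_Frame p qs xs vs) =
    pair 0 (pair (recf_code p) (pair (list_code (map recf_code qs)) (pair (list_code xs) (list_code vs))))"
| "frame_code (Prec_Frame q ys m n) =
    pair 1 (pair (recf_code q) (pair (list_code ys) (pair m n)))"
| "frame_code (Mu_Frame p xs z) = pair 2 (pair (recf_code p) (pair (list_code xs) z))"

fun state_code :: "state \<Rightarrow> nat" where
  "state_code (Eval p xs K) =
    pair 0 (pair (recf_code p) (pair (list_code xs) (list_code (map frame_code K))))"
| "state_code (Args p qs xs vs K) =
    pair 1 (pair (recf_code p) (pair (list_code (map recf_code qs))
      (pair (list_code xs) (pair (list_code vs) (list_code (map frame_code K))))))"
| "state_code (Ret v K) = pair 2 (pair v (list_code (map frame_code K)))"
| "state_code Stuck = pair 3 0"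

definition code_cons :: "nat \<Rightarrow> nat \<Rightarrow> nat" where
  "code_cons x l = pair 1 (pair x l)"

definition code_hd :: "nat \<Rightarrow> nat" where
  "code_hd l = pfst (psnd l)"

definition code_tl :: "nat \<Rightarrow> nat" where
  "code_tl l = psnd (psnd l)"

definition code_eval :: "nat \<Rightarrow> nat \<Rightarrow> nat \<Rightarrow> nat" where
  "code_eval p xs K = pair 0 (pair p (pair xs K))"

definition code_args :: "nat \<Rightarrow> nat \<Rightarrow> nat \<Rightarrow> nat \<Rightarrow> nat \<Rightarrow> nat" where
  "code_args p qs xs vs K = pair 1 (pair p (pair qs (pair xs (pair vs K))))"

definition code_ret :: "nat \<Rightarrow> nat \<Rightarrow> nat" where
  "code_ret v K = pair 2 (pair v K)"

definition eval_step :: "nat \<Rightarrow> nat \<Rightarrow> nat \<Rightarrow> nat" where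
  "eval_step p xs K =
    (if pfst p = 0 then code_ret 0 K
     else if pfst p = 1 then (if pfst xs = 0 then pair 3 0 else code_ret (Suc (code_hd xs)) K)
     else if pfst p = 2 then
       (if pfst xs = 0 then pair 3 0
        else if psnd p = 0 then code_ret (code_hd xs) K
        else code_eval (pair 2 (psnd p - 1)) (code_tl xs) K)
     else if pfst p = 3 then code_args (pfst (psnd p)) (psnd (psnd p)) xs (pair 0 0) K
     else if pfst p = 4 then
       (if pfst xs = 0 then pair 3 0
        else code_eval (pfst (psnd p)) (code_tl xs)
          (code_cons (pair 1 (pair (psnd (psnd p)) (pair (code_tl xs) (pair 0 (code_hd xs))))) K))
     else code_eval (psnd p) (code_cons 0 xs)
       (code_cons (pair 2 (pair (psnd p) (pair xs 0))) K))"

definition args_step :: "nat \<Rightarrow> nat \<Rightarrow> nat \<Rightarrow> nat \<Rightarrow> nat \<Rightarrow> nat" where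
  "args_step p qs xs vs K =
    (if pfst qs = 0 then code_eval p vs K
     else code_eval (code_hd qs) xs
       (code_cons (pair 0 (pair p (pair (code_tl qs) (pair xs vs)))) K))"

definition frame_step :: "nat \<Rightarrow> nat \<Rightarrow> nat \<Rightarrow> nat \<Rightarrow> nat" where
  "frame_step v F G K =
    (if pfst F = 0 then
       code_args (pfst G) (pfst (psnd G)) (pfst (psnd (psnd G)))
         (code_cons v (psnd (psnd (psnd G)))) K
     else if pfst F = 1 then
       (if psnd (psnd (psnd G)) = 0 then code_ret v K
        else code_eval (pfst G)
          (code_cons (pfst (psnd (psnd G))) (code_cons v (pfst (psnd G))))
          (code_cons (pair 1 (pair (pfst G) (pair (pfst (psnd G))
            (pair (Suc (pfst (psnd (psnd G)))) (psnd (psnd (psnd G)) - 1))))) K))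
     else if v = 0 then code_ret (psnd (psnd G)) K
     else code_eval (pfst G) (code_cons (Suc (psnd (psnd G))) (pfst (psnd G)))
       (code_cons (pair 2 (pair (pfst G) (pair (pfst (psnd G)) (Suc (psnd (psnd G)))))) K))"

definition code_step :: "nat \<Rightarrow> nat" where
  "code_step st =
    (if pfst st = 0 then
       eval_step (pfst (psnd st)) (pfst (psnd (psnd st))) (psnd (psnd (psnd st)))
     else if pfst st = 1 then
       args_step (pfst (psnd st)) (pfst (psnd (psnd st))) (pfst (psnd (psnd (psnd st))))
         (pfst (psnd (psnd (psnd (psnd st))))) (psnd (psnd (psnd (psnd (psnd st)))))
     else if pfst st = 2 \<and> pfst (psnd (psnd st)) \<noteq> 0 then
       frame_step (pfst (psnd st)) (code_hd (psnd (psnd st))) (psnd (code_hd (psnd (psnd st))))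
         (code_tl (psnd (psnd st)))
     else st)"

lemmas code_step_defs =
  code_cons_def code_hd_def code_tl_def code_eval_def code_args_def code_ret_def
  eval_step_def args_step_def frame_step_def code_step_def

lemma state_code_step: "state_code (step st) = code_step (state_code st)"
  by (cases st rule: step.cases) (simp_all add: code_step_defs rev_map)

lemma state_code_funpow_step: "state_code ((step ^^ n) st) = (code_step ^^ n) (state_code st)"
  by (induction n) (simp_all add: state_code_step)

lemma computable_code_step: "computable code_step"
proof -
  have "computable (\<lambda>st. code_step st)"
    unfolding code_step_defs by (intro computable_intros)
  then show ?thesis .
qed

text \<open>
  The result \<open>0\<close> stands for ``not yet halted'', and \<open>Suc v\<close> for the value \<open>v\<close>.
\<close>

definition value_within :: "nat \<Rightarrow> nat \<Rightarrow> nat \<Rightarrow> nat" where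
  "value_within s e l =
    (let st = (code_step ^^ s) (pair 0 (pair e (pair l (pair 0 0))))
     in if pfst st = 2 \<and> pfst (psnd (psnd st)) = 0 then Suc (pfst (psnd st)) else 0)"

lemma computable_value_within:
  assumes "computable f" and "computable g" and "computable h"
  shows "computable (\<lambda>x. value_within (f x) (g x) (h x))"
  unfolding value_within_def Let_def
  by (intro computable_intros assms computable_compose [OF computable_code_step])

lemma value_within_eq_Suc_iff:
  "value_within s (recf_code p) (list_code xs) = Suc v \<longleftrightarrow> (step ^^ s) (Eval p xs []) = Ret v []"
proof -
  have "(code_step ^^ s) (pair 0 (pair (recf_code p) (pair (list_code xs) (pair 0 0)))) =
      state_code ((step ^^ s) (Eval p xs []))"
    by (simp add: state_code_funpow_step)
  moreover have "pfst (list_code (map frame_code K)) = 0 \<longleftrightarrow> K = []" for K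
    by (cases K) simp_all
  ultimately show ?thesis
    by (cases "(step ^^ s) (Eval p xs [])") (auto simp: value_within_def Let_def)
qed

lemma value_within_mono:
  assumes "value_within s (recf_code p) (list_code xs) = Suc v" and "s \<le> s'"
  shows "value_within s' (recf_code p) (list_code xs) = Suc v"
proof -
  obtain d where "s' = d + s"
    using assms(2) le_Suc_ex by (metis add.commute)
  then show ?thesis
    using assms(1) by (simp add: value_within_eq_Suc_iff funpow_add funpow_step_halted)
qed

lemma recf_eval_iff_value_within:
  "recf_eval p xs = Some v \<longleftrightarrow> (\<exists>s. value_within s (recf_code p) (list_code xs) = Suc v)"
  by (simp add: value_within_eq_Suc_iff recf_eval_iff_halts)

section \<open>Stagewise approximation of a computable family\<close>

definition computable3 :: "(nat \<Rightarrow> nat \<Rightarrow> nat \<Rightarrow> nat) \<Rightarrow> bool" where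
  "computable3 F \<longleftrightarrow> computable (\<lambda>z. F (pfst z) (pfst (psnd z)) (psnd (psnd z)))"

lemma computable3D:
  "computable3 F \<Longrightarrow> computable f \<Longrightarrow> computable g \<Longrightarrow> computable h \<Longrightarrow>
    computable (\<lambda>x. F (f x) (g x) (h x))"
  unfolding computable3_def by (rule computable_compose3)

text \<open>
  As above, \<open>0\<close> means ``no value yet'' and \<open>Suc y\<close> the value \<open>y\<close>. The bound \<open>x < s\<close> makes every
  stage a finite function whose domain can be searched effectively; this finite function is what a
  released slot hands over to strong density.
\<close>

definition approximates :: "(nat \<Rightarrow> nat \<Rightarrow> nat \<Rightarrow> nat) \<Rightarrow> (nat \<Rightarrow> nat \<rightharpoonup> nat) \<Rightarrow> bool" where
  "approximates F f \<longleftrightarrow>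
    (\<forall>s i x y. F s i x = Suc y \<longrightarrow> x < s \<and> f i x = Some y) \<and>
    (\<forall>s s' i x y. F s i x = Suc y \<longrightarrow> s \<le> s' \<longrightarrow> F s' i x = Suc y) \<and>
    (\<forall>i x y. f i x = Some y \<longrightarrow> (\<exists>s. F s i x = Suc y))"

lemma approximates_bound: "approximates F f \<Longrightarrow> F s i x = Suc y \<Longrightarrow> x < s"
  and approximates_sound: "approximates F f \<Longrightarrow> F s i x = Suc y \<Longrightarrow> f i x = Some y"
  and approximates_mono: "approximates F f \<Longrightarrow> F s i x = Suc y \<Longrightarrow> s \<le> s' \<Longrightarrow> F s' i x = Suc y"
  and approximates_complete: "approximates F f \<Longrightarrow> f i x = Some y \<Longrightarrow> \<exists>s. F s i x = Suc y"
  unfolding approximates_def by blast+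

lemma approximates_limit:
  assumes "approximates F f"
  shows "\<exists>s0. \<forall>s\<ge>s0. F s i x = case_option 0 Suc (f i x)"
proof (cases "f i x")
  case None
  have "F s i x = 0" for s
    using approximates_sound [OF assms, of s i x] None by (cases "F s i x") auto
  with None show ?thesis by simp
next
  case (Some y)
  then obtain s0 where "F s0 i x = Suc y"
    using approximates_complete [OF assms] by blast
  then have "\<forall>s\<ge>s0. F s i x = Suc y"
    using approximates_mono [OF assms] by blast
  with Some show ?thesis by auto
qed

lemma common_stage:
  fixes n :: nat
  assumes "\<And>i. i < n \<Longrightarrow> \<exists>s0::nat. \<forall>s\<ge>s0. P i s"
  shows "\<exists>s0. \<forall>s\<ge>s0. \<forall>i<n. P i s"
  using assms
proof (induction n)
  case (Suc n)
  have "\<exists>s0. \<forall>s\<ge>s0. \<forall>i<n. P i s"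
    by (rule Suc.IH) (simp add: Suc.prems)
  moreover have "\<exists>s0. \<forall>s\<ge>s0. P n s"
    by (rule Suc.prems) simp
  ultimately obtain s1 s2 where "\<forall>s\<ge>s1. \<forall>i<n. P i s" "\<forall>s\<ge>s2. P n s"
    by blast
  then have "\<forall>s\<ge>max s1 s2. \<forall>i<Suc n. P i s"
    by (auto simp: less_Suc_eq)
  then show ?case ..
qed simp

lemma ex_approximates:
  assumes "partial_computable2 f"
  shows "\<exists>F. approximates F f \<and> computable3 F"
proof -
  obtain p where p: "\<And>i x. recf_eval p [i, x] = f i x"
    using assms unfolding partial_computable2_def by blast
  define F where
    "F s i x = (if x < s then value_within s (recf_code p) (list_code [i, x]) else 0)" for s i x
  have "approximates F f"
    unfolding approximates_def
  proof (intro conjI allI impI)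
    fix s i x y assume "F s i x = Suc y"
    then show "x < s" "f i x = Some y"
      using recf_eval_iff_value_within [of p "[i, x]" y] unfolding F_def p
      by (auto split: if_splits)
  next
    fix s s' i x y assume "F s i x = Suc y" "s \<le> s'"
    then show "F s' i x = Suc y"
      using value_within_mono [of s p "[i, x]" y s'] unfolding F_def by (auto split: if_splits)
  next
    fix i x y assume "f i x = Some y"
    then obtain s where "value_within s (recf_code p) (list_code [i, x]) = Suc y"
      using recf_eval_iff_value_within [of p "[i, x]" y] unfolding p by blast
    then have "value_within (max s (Suc x)) (recf_code p) (list_code [i, x]) = Suc y"
      by (rule value_within_mono) simp
    then show "\<exists>s. F s i x = Suc y"
      unfolding F_def by (intro exI [of _ "max s (Suc x)"]) simp
  qed
  moreover have "computable3 F"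
    unfolding computable3_def F_def list_code.simps
    by (intro computable_intros computable_value_within)
  ultimately show ?thesis by blast
qed

text \<open>
  The final numberings are defined by unbounded search for a stage at which a value has appeared.
  Here the search may fail, and its divergence is the undefinedness of the resulting function.
\<close>

lemma partial_computable3_search:
  assumes "computable (\<lambda>z. W (pfst z) (pfst (psnd z)) (pfst (psnd (psnd z))) (psnd (psnd (psnd z))))"
  shows "partial_computable3 (\<lambda>k n x.
    if \<exists>z. W k n x z \<noteq> 0 then Some (W k n x (LEAST z. W k n x z \<noteq> 0) - 1) else None)"
proof -
  obtain p where p: "\<And>z. recf_eval p [z] =
      Some (W (pfst z) (pfst (psnd z)) (pfst (psnd (psnd z))) (psnd (psnd (psnd z))))"
    using assms unfolding computable_iff by blast
  obtain r where r: "\<And>y. recf_eval r [y] = Some (1 - y)"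
    using computable_diff [OF computable_const computable_id] unfolding computable_iff by blast
  define v where "v = Comp p [Comp pair_prog [Proj 1, Comp pair_prog [Proj 2, Comp pair_prog [Proj 3, Proj 0]]]]"
  define m where "m = Mu (Comp r [v])"
  define q where "q = Comp pred_prog [Comp v [m, Proj 0, Proj 1, Proj 2]]"
  have v: "recf_eval v [z, k, n, x] = Some (W k n x z)" for z k n x
    by (simp add: v_def p)
  have "recf_eval (Comp r [v]) [z, k, n, x] = Some (1 - W k n x z)" for z k n x
    by (simp add: v r)
  note search = recf_eval_Mu_total [OF this]
  have "1 - w = 0 \<longleftrightarrow> w \<noteq> 0" for w :: nat
    by auto
  then have m: "recf_eval m [k, n, x] =
      (if \<exists>z. W k n x z \<noteq> 0 then Some (LEAST z. W k n x z \<noteq> 0) else None)" for k n x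
    unfolding m_def search by (simp only:)
  show ?thesis
    unfolding partial_computable3_def
    by (rule exI [of _ q]) (auto simp: q_def m v)
qed

lemma partial_computable3_section:
  assumes "partial_computable3 f"
  shows "partial_computable2 (f k)"
proof -
  obtain p where p: "\<And>i n x. recf_eval p [i, n, x] = f i n x"
    using assms unfolding partial_computable3_def by blast
  obtain c where c: "\<And>x. recf_eval c [x] = Some k"
    using computable_const [of k] unfolding computable_iff by blast
  have "recf_eval (Comp p [Comp c [Proj 0], Proj 0, Proj 1]) [n, x] = f k n x" for n x
    by (simp add: p c)
  then show ?thesis unfolding partial_computable2_def by blast
qed

section \<open>Followers and released slots\<close>

locale friedberg_construction =
  fixes \<alpha> \<beta> \<gamma> :: "nat \<Rightarrow> nat \<rightharpoonup> nat"
    and FA FB FC :: "nat \<Rightarrow> nat \<Rightarrow> nat \<Rightarrow> nat"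
  assumes FA: "approximates FA \<alpha>" "computable3 FA"
    and FB: "approximates FB \<beta>" "computable3 FB"
    and FC: "approximates FC \<gamma>" "computable3 FC"
    and inj_\<beta>: "inj \<beta>" and inj_\<gamma>: "inj \<gamma>"
    and disjoint: "range \<alpha> \<inter> range \<beta> = {}" "range \<alpha> \<inter> range \<gamma> = {}" "range \<beta> \<inter> range \<gamma> = {}"
    and dense: "strongly_dense_in (range \<beta>) (range \<alpha> \<union> range \<gamma>)"
begin

text \<open>
  One index set for all followed functions. An index with first component \<open>0\<close> belongs to \<open>\<alpha>\<close>; the
  index \<open>pair (Suc k) e\<close> belongs to \<open>\<gamma> (pair k e)\<close>, the witness of the \<open>k\<close>-th numbering against
  program \<open>e\<close>. As \<open>pair\<close> is onto, every \<open>\<gamma> c\<close> has exactly one such index.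
\<close>

definition \<delta> :: "nat \<Rightarrow> nat \<rightharpoonup> nat" where
  "\<delta> d = (if pfst d = 0 then \<alpha> (psnd d) else \<gamma> (pair (pfst d - 1) (psnd d)))"

definition FD :: "nat \<Rightarrow> nat \<Rightarrow> nat \<Rightarrow> nat" where
  "FD s d x = (if pfst d = 0 then FA s (psnd d) x else FC s (pair (pfst d - 1) (psnd d)) x)"

lemma approximates_FD: "approximates FD \<delta>"
  unfolding approximates_def FD_def \<delta>_def
  using FA(1) FC(1) by (auto intro: approximates_bound approximates_sound approximates_mono
      approximates_complete)

text \<open>
  A slot is the number \<open>pair d t\<close>, where \<open>d\<close> is the index of the followed function and \<open>t\<close> is the
  stage at which the slot was created. The first disjunct compares \<open>\<alpha>\<close> at the indices \<open>psnd d\<close> and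
  \<open>j\<close> on the arguments below \<open>t\<close>, so later slots are harder to release. The second disjunct is the
  diagonalization: it concerns only the first slot of a witness that is reserved for the \<open>k\<close>-th
  numbering, and asks whether the program of the witness maps this slot to itself.
\<close>

definition releases :: "nat \<Rightarrow> nat \<Rightarrow> nat \<Rightarrow> nat \<Rightarrow> bool" where
  "releases k d t n \<longleftrightarrow>
    (pfst d = 0 \<and> (\<exists>j<psnd d. \<forall>y<t. FA n (psnd d) y = FA n j y)) \<or>
    (pfst d = Suc k \<and> t = 0 \<and>
      value_within n (psnd d) (list_code [pair d 0]) = Suc (pair d 0))"

text \<open>
  \<open>follower k d s\<close> is the creation stage of the slot that follows \<open>\<delta> d\<close> at stage \<open>s\<close> of its own
  clock. All clocks run interleaved: step \<open>n\<close> of the construction is stage \<open>psnd n\<close> for the index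
  \<open>pfst n\<close>, and the approximations are consulted at stage \<open>n\<close>.
\<close>

definition follower :: "nat \<Rightarrow> nat \<Rightarrow> nat \<Rightarrow> nat" where
  "follower k d s = rec_nat 0 (\<lambda>m t. if releases k d t (pair d m) then Suc m else t) s"

definition released :: "nat \<Rightarrow> nat \<Rightarrow> bool" where
  "released k n \<longleftrightarrow> releases k (pfst n) (follower k (pfst n) (psnd n)) n"

text \<open>
  Step \<open>n = pair d s\<close> creates the slot \<open>pair d (Suc s)\<close> and gives exactly one slot to \<open>\<beta>\<close>: the current
  follower if that is released, and otherwise the new slot, which has not shown anything yet. Having
  exactly one such slot per step turns the assignment of members of \<open>B\<close> into a bijection between
  steps and indices of \<open>\<beta>\<close>.
\<close>

definition pooled :: "nat \<Rightarrow> nat \<Rightarrow> nat" where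
  "pooled k n = pair (pfst n)
    (if released k n then follower k (pfst n) (psnd n) else Suc (psnd n))"

lemma follower_0 [simp]: "follower k d 0 = 0"
  by (simp add: follower_def)

lemma follower_Suc:
  "follower k d (Suc s) = (if released k (pair d s) then Suc s else follower k d s)"
  by (simp add: follower_def released_def)

lemma follower_le: "follower k d s \<le> s"
  by (induction s) (auto simp: follower_Suc)

text \<open>
  A follower is only ever replaced by a slot that was created later.
\<close>

lemma follower_abandoned:
  assumes "follower k d s \<noteq> t" and "t \<le> s" and "s \<le> s'"
  shows "follower k d s' \<noteq> t"
  using assms(3)
proof (induction rule: dec_induct)
  case (step r)
  then show ?case using assms(2) by (simp add: follower_Suc)
qed (use assms in simp)

lemma pooled_abandoned:
  assumes "pooled k (pair d s) = pair d t" and "s < s'"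
  shows "t \<le> Suc s" and "follower k d s' \<noteq> t"
proof -
  show t: "t \<le> Suc s"
    using assms(1) follower_le [of k d s] by (auto simp: pooled_def split: if_splits)
  have "follower k d (Suc s) \<noteq> t"
  proof (cases "released k (pair d s)")
    case True
    with assms(1) have "t = follower k d s" by (simp add: pooled_def)
    with True show ?thesis using follower_le [of k d s] by (simp add: follower_Suc)
  next
    case False
    with assms(1) have "t = Suc s" by (simp add: pooled_def)
    with False show ?thesis using follower_le [of k d s] by (simp add: follower_Suc)
  qed
  then show "follower k d s' \<noteq> t"
    by (rule follower_abandoned) (use t assms(2) in auto)
qed

lemma inj_pooled: "inj (pooled k)"
proof -
  have *: "\<not> s < s'" if "pooled k (pair d s) = pair d t" "pooled k (pair d s') = pair d t" for d t s s'
  proof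
    assume "s < s'"
    note pooled_abandoned [OF that(1) this]
    with that(2) \<open>s < s'\<close> show False
      by (auto simp: pooled_def split: if_splits)
  qed
  show ?thesis
  proof (rule injI)
    fix n n' assume eq: "pooled k n = pooled k n'"
    define d s s' where "d = pfst n" and "s = psnd n" and "s' = psnd n'"
    have "pfst n' = pfst n"
      using eq by (simp add: pooled_def)
    then have n: "n = pair d s" "n' = pair d s'"
      using pair_pfst_psnd [of n] pair_pfst_psnd [of n'] by (simp_all add: d_def s_def s'_def)
    obtain t where "pooled k n = pair d t"
      by (simp add: pooled_def d_def)
    with eq n * have "\<not> s < s'" "\<not> s' < s" by auto
    with n show "n = n'" by simp
  qed
qed

text \<open>
  This dichotomy decides the value of every slot: \<open>\<nu>_pooled\<close> treats one side and \<open>\<nu>_follower\<close>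
  the other. A slot that escapes the pool must have become a follower at its own creation, and it
  can stop being the follower only by joining the pool.
\<close>

lemma never_pooled_iff:
  "(\<forall>n. pooled k n \<noteq> pair d t) \<longleftrightarrow> (\<forall>s\<ge>t. follower k d s = t)"
proof
  assume never: "\<forall>n. pooled k n \<noteq> pair d t"
  show "\<forall>s\<ge>t. follower k d s = t"
  proof (intro allI impI)
    fix s assume "t \<le> s"
    then show "follower k d s = t"
    proof (induction rule: dec_induct)
      case base
      show ?case
      proof (cases t)
        case (Suc r)
        then show ?thesis
          using never [rule_format, of "pair d r"] by (simp add: pooled_def follower_Suc split: if_splits)
      qed simp
    next
      case (step s)
      then show ?case
        using never [rule_format, of "pair d s"] by (simp add: pooled_def follower_Suc split: if_splits)
    qed
  qed
next
  assume stays: "\<forall>s\<ge>t. follower k d s = t"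
  show "\<forall>n. pooled k n \<noteq> pair d t"
  proof (intro allI notI)
    fix n assume n: "pooled k n = pair d t"
    then have "pooled k (pair d (psnd n)) = pair d t"
      using pair_pfst_psnd [of n] by (simp add: pooled_def)
    from pooled_abandoned [OF this lessI] stays show False by simp
  qed
qed

section \<open>Distributing the members of B\<close>

text \<open>
  The history is the list of the \<open>\<beta>\<close>-indices given away so far, as iterated pairs with the most
  recent entry first.
\<close>

definition history_entry :: "nat \<Rightarrow> nat \<Rightarrow> nat" where
  "history_entry U i = pfst ((psnd ^^ i) U)"

text \<open>
  \<open>z\<close> codes an index \<open>pfst z\<close> of \<open>\<beta>\<close> and a stage \<open>psnd z\<close> at which that function is seen to extend
  what a released slot may have shown before step \<open>n\<close>. Searching for index and stage together makes
  the condition decidable.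
\<close>

definition candidate :: "nat \<Rightarrow> nat \<Rightarrow> nat \<Rightarrow> nat \<Rightarrow> bool" where
  "candidate k n U z \<longleftrightarrow> (\<forall>i<n. history_entry U i \<noteq> pfst z) \<and>
    (released k n \<longrightarrow>
      (\<forall>x<n. FD n (pfst n) x = 0 \<or> FB (psnd z) (pfst z) x = FD n (pfst n) x))"

definition least_candidate :: "nat \<Rightarrow> nat \<Rightarrow> nat \<Rightarrow> nat" where
  "least_candidate k n U = (LEAST z. candidate k n U z)"

definition history :: "nat \<Rightarrow> nat \<Rightarrow> nat" where
  "history k n = rec_nat 0 (\<lambda>m U. pair (pfst (least_candidate k m U)) U) n"

definition assigned :: "nat \<Rightarrow> nat \<Rightarrow> nat" where
  "assigned k n = pfst (least_candidate k n (history k n))"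

lemma history_entry_pair_0 [simp]: "history_entry (pair b U) 0 = b"
  and history_entry_pair_Suc [simp]: "history_entry (pair b U) (Suc i) = history_entry U i"
  by (simp_all add: history_entry_def funpow_swap1)

lemma history_entry_history: "i < n \<Longrightarrow> history_entry (history k n) i = assigned k (n - Suc i)"
proof (induction n arbitrary: i)
  case (Suc n)
  have "history k (Suc n) = pair (assigned k n) (history k n)"
    by (simp add: history_def assigned_def)
  with Suc show ?case by (cases i) simp_all
qed simp

lemma \<delta>_in: "\<delta> d \<in> range \<alpha> \<union> range \<gamma>"
  by (simp add: \<delta>_def)

text \<open>
  This is the use of strong density: infinitely many members of \<open>B\<close> extend the finite function seen
  so far, and only finitely many of them are taken. The list \<open>U\<close> is arbitrary, so that the search
  is total and thereby computable.
\<close>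

lemma ex_candidate: "\<exists>z. candidate k n U z"
proof -
  define d where "d = pfst n"
  define used where "used = history_entry U ` {..<n}"
  define D where "D = {x. x < n \<and> FD n d x \<noteq> 0}"
  have "infinite {g \<in> range \<beta>. \<delta> d |` D \<subseteq>\<^sub>m g}"
    using dense \<delta>_in [of d] unfolding strongly_dense_in_def D_def by auto
  moreover have "finite (\<beta> ` used)"
    by (simp add: used_def)
  ultimately have "{g \<in> range \<beta>. \<delta> d |` D \<subseteq>\<^sub>m g} - \<beta> ` used \<noteq> {}"
    by (metis Diff_infinite_finite infinite_imp_nonempty)
  then obtain b where b: "\<delta> d |` D \<subseteq>\<^sub>m \<beta> b" "b \<notin> used"
    by auto
  have "\<exists>s0. \<forall>s\<ge>s0. FD n d x = 0 \<or> FB s b x = FD n d x" if "x < n" for x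
  proof (cases "FD n d x")
    case (Suc y)
    with that have "x \<in> D" by (simp add: D_def)
    moreover have "\<delta> d x = Some y"
      using approximates_sound [OF approximates_FD Suc] .
    ultimately have "\<beta> b x = Some y"
      using b(1) by (force simp: map_le_def restrict_map_def)
    with Suc show ?thesis
      using approximates_limit [OF FB(1), of b x] by auto
  qed simp
  then have "\<exists>s0. \<forall>s\<ge>s0. \<forall>x<n. FD n d x = 0 \<or> FB s b x = FD n d x"
    by (rule common_stage)
  then obtain s where "\<forall>x<n. FD n d x = 0 \<or> FB s b x = FD n d x" by blast
  with b(2) have "candidate k n U (pair b s)"
    by (auto simp: candidate_def d_def used_def)
  then show ?thesis ..
qed

lemma candidate_least_candidate: "candidate k n U (least_candidate k n U)"
  unfolding least_candidate_def by (rule LeastI_ex) (rule ex_candidate)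

lemma assigned_fresh: "m < n \<Longrightarrow> assigned k m \<noteq> assigned k n"
proof -
  assume "m < n"
  then have "history_entry (history k n) (n - Suc m) = assigned k m"
    by (subst history_entry_history) auto
  with \<open>m < n\<close> show ?thesis
    using candidate_least_candidate [of k n "history k n"] unfolding candidate_def assigned_def
    by (metis diff_less zero_less_Suc gr_implies_not0 neq0_conv)
qed

lemma inj_assigned: "inj (assigned k)"
  by (rule linorder_injI) (rule assigned_fresh)

lemma assigned_extends:
  assumes "released k n" and "FD n (pfst n) x = Suc y"
  shows "\<beta> (assigned k n) x = Some y"
proof -
  have "x < n"
    using approximates_bound [OF approximates_FD assms(2)] .
  then have "FB (psnd (least_candidate k n (history k n))) (assigned k n) x = Suc y"
    using candidate_least_candidate [of k n "history k n"] assms unfolding candidate_def assigned_def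
    by (metis nat.distinct(1))
  then show ?thesis by (rule approximates_sound [OF FB(1)])
qed

text \<open>
  A witness reserved for another numbering is never released, and so every step at its index is free
  of constraints.
\<close>

lemma infinite_not_released: "infinite {n. \<not> released k n}"
proof -
  \<comment> \<open>any index of a witness for a numbering other than the \<open>k\<close>-th would do\<close>
  have "\<not> released k (pair (pair (Suc (Suc k)) 0) s)" for s
    by (simp add: released_def releases_def)
  then have "range (pair (pair (Suc (Suc k)) 0)) \<subseteq> {n. \<not> released k n}"
    by auto
  moreover have "infinite (range (pair (pair (Suc (Suc k)) 0)))"
    by (subst finite_image_iff) (simp_all add: inj_def)
  ultimately show ?thesis using infinite_super by blast
qed

text \<open>
  If \<open>\<beta> b\<close> were never given away, then \<open>pair b 0\<close> would be a candidate at each of the infinitely many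
  unconstrained steps. The least candidates of these steps are then bounded by \<open>pair b 0\<close>; but they
  are pairwise distinct, since no index of \<open>\<beta>\<close> is given away twice.
\<close>

lemma surj_assigned: "surj (assigned k)"
proof (rule ccontr)
  assume "\<not> surj (assigned k)"
  then obtain b where b: "\<And>n. assigned k n \<noteq> b" by (metis surj_def)
  let ?pick = "\<lambda>n. least_candidate k n (history k n)"
  have "?pick n \<le> pair b 0" if "\<not> released k n" for n
  proof -
    have "candidate k n (history k n) (pair b 0)"
      using that b by (simp add: candidate_def history_entry_history)
    then show ?thesis unfolding least_candidate_def by (rule Least_le)
  qed
  then have "?pick ` {n. \<not> released k n} \<subseteq> {..pair b 0}"
    by auto
  moreover have "inj_on ?pick {n. \<not> released k n}"
    by (rule inj_onI) (rule injD [OF inj_assigned [of k]], simp add: assigned_def)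
  ultimately show False
    using infinite_not_released [of k] by (meson finite_atMost finite_imageD finite_subset)
qed

section \<open>The numberings\<close>

text \<open>
  \<open>z\<close> codes a stage \<open>pfst z\<close> and a guess \<open>psnd z\<close> for the step at which the slot \<open>a\<close> is pooled. The
  followed function may be consulted only before that step, since only the values seen by then are
  known to be shared by the assigned member of \<open>B\<close>; and only if \<open>a\<close> did become a follower when it
  was created, since a slot pooled at once receives a member of \<open>B\<close> chosen without regard to \<open>\<delta>\<close>.
\<close>

definition stage_value :: "nat \<Rightarrow> nat \<Rightarrow> nat \<Rightarrow> nat \<Rightarrow> nat" where
  "stage_value k a x z =
    (if pooled k (psnd z) = a then FB (pfst z) (assigned k (psnd z)) x
     else if follower k (pfst a) (psnd a) = psnd a \<and> (\<forall>m<pfst z. pooled k m \<noteq> a)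
     then FD (pfst z) (pfst a) x else 0)"

definition \<nu> :: "nat \<Rightarrow> nat \<Rightarrow> nat \<rightharpoonup> nat" where
  "\<nu> k a x = (if \<exists>z. stage_value k a x z \<noteq> 0
    then Some (stage_value k a x (LEAST z. stage_value k a x z \<noteq> 0) - 1) else None)"

lemma \<nu>_eqI:
  assumes "\<And>z y. stage_value k a x z = Suc y \<Longrightarrow> r = Some y"
    and "\<And>y. r = Some y \<Longrightarrow> \<exists>z. stage_value k a x z \<noteq> 0"
  shows "\<nu> k a x = r"
proof (cases "\<exists>z. stage_value k a x z \<noteq> 0")
  case True
  then have "stage_value k a x (LEAST z. stage_value k a x z \<noteq> 0) \<noteq> 0"
    by (rule LeastI_ex)
  then obtain y where "stage_value k a x (LEAST z. stage_value k a x z \<noteq> 0) = Suc y"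
    using not0_implies_Suc by blast
  with True assms(1) show ?thesis
    by (auto simp: \<nu>_def)
next
  case False
  with assms(2) show ?thesis
    by (cases r) (auto simp: \<nu>_def)
qed

text \<open>
  A pooled slot may have shown values of the followed function first. It showed them at stages up to
  the step of its release, and the assigned member of \<open>B\<close> was chosen to extend them.
\<close>

lemma \<nu>_pooled: "\<nu> k (pooled k n) = \<beta> (assigned k n)"
proof (rule ext, rule \<nu>_eqI)
  fix x z y assume out: "stage_value k (pooled k n) x z = Suc y"
  show "\<beta> (assigned k n) x = Some y"
  proof (cases "pooled k (psnd z) = pooled k n")
    case True
    then have "psnd z = n"
      by (rule injD [OF inj_pooled])
    with out have "FB (pfst z) (assigned k n) x = Suc y"
      by (simp add: stage_value_def)
    then show ?thesis by (rule approximates_sound [OF FB(1)])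
  next
    case False
    with out have active: "follower k (pfst (pooled k n)) (psnd (pooled k n)) = psnd (pooled k n)"
      and early: "\<forall>m<pfst z. pooled k m \<noteq> pooled k n"
      and FD_z: "FD (pfst z) (pfst n) x = Suc y"
      by (auto simp: stage_value_def pooled_def split: if_splits)
    \<comment> \<open>a slot that is pooled without a release was never a follower, hence has shown nothing\<close>
    have "released k n"
    proof (rule ccontr)
      assume "\<not> released k n"
      with active have "follower k (pfst n) (Suc (psnd n)) = Suc (psnd n)"
        by (simp add: pooled_def)
      with \<open>\<not> released k n\<close> show False
        using follower_le [of k "pfst n" "psnd n"] by (simp add: follower_Suc)
    qed
    moreover have "FD n (pfst n) x = Suc y"
      by (rule approximates_mono [OF approximates_FD FD_z]) (use early not_le in blast)
    ultimately show ?thesis by (rule assigned_extends)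
  qed
next
  fix x y assume "\<beta> (assigned k n) x = Some y"
  then obtain s where "FB s (assigned k n) x = Suc y"
    using approximates_complete [OF FB(1)] by blast
  then show "\<exists>z. stage_value k (pooled k n) x z \<noteq> 0"
    by (intro exI [of _ "pair s n"]) (simp add: stage_value_def)
qed

lemma \<nu>_follower:
  assumes stays: "\<forall>s\<ge>t. follower k d s = t"
  shows "\<nu> k (pair d t) = \<delta> d"
proof -
  have out: "stage_value k (pair d t) x z = FD (pfst z) d x" for x z
    using never_pooled_iff [of k d t] stays by (auto simp: stage_value_def)
  show ?thesis
  proof (rule ext, rule \<nu>_eqI)
    fix x z y assume "stage_value k (pair d t) x z = Suc y"
    then show "\<delta> d x = Some y"
      unfolding out by (rule approximates_sound [OF approximates_FD])
  next
    fix x y assume "\<delta> d x = Some y"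
    then obtain s where "FD s d x = Suc y"
      using approximates_complete [OF approximates_FD] by blast
    then show "\<exists>z. stage_value k (pair d t) x z \<noteq> 0"
      by (intro exI [of _ "pair s 0"]) (simp add: out)
  qed
qed

lemma \<nu>_cases:
  obtains (pooled) n where "a = pooled k n"
  | (follower) "\<forall>s\<ge>psnd a. follower k (pfst a) s = psnd a"
  using never_pooled_iff [of k "pfst a" "psnd a"] by (metis pair_pfst_psnd)

text \<open>
  If late slots are not released at late stages, then the first release at a late stage, if there is
  one, installs a permanent follower; if there is none, the follower of stage \<open>N\<close> is permanent.
\<close>

lemma follower_stabilizes:
  assumes "\<And>t s. N \<le> t \<Longrightarrow> N \<le> s \<Longrightarrow> \<not> releases k d t (pair d s)"
  shows "\<exists>t. \<forall>s\<ge>t. follower k d s = t"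
proof (cases "\<exists>s\<ge>N. released k (pair d s)")
  case True
  then obtain s where s: "N \<le> s" "released k (pair d s)" by blast
  have "follower k d r = Suc s" if "Suc s \<le> r" for r
    using that
  proof (induction rule: dec_induct)
    case base
    show ?case using s(2) by (simp add: follower_Suc)
  next
    case (step r)
    then show ?case
      using assms [of "Suc s" r] s(1) by (simp add: follower_Suc released_def)
  qed
  then show ?thesis by blast
next
  case False
  define t where "t = follower k d N"
  have late: "follower k d r = t" if "N \<le> r" for r
    using that
  proof (induction rule: dec_induct)
    case (step r)
    then show ?case using False by (simp add: follower_Suc)
  qed (simp add: t_def)
  have "follower k d r = t" if "t \<le> r" for r
    using follower_abandoned [OF _ that, of k d "max r N"] late [of "max r N"] by auto
  then show ?thesis by blast
qed

text \<open>
  Only the first slot of a witness can be released, so the second one is safe.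
\<close>

lemma ex_follower_\<gamma>:
  assumes "pfst d \<noteq> 0"
  shows "\<exists>t. \<forall>s\<ge>t. follower k d s = t"
  using assms by (intro follower_stabilizes [of 1]) (auto simp: releases_def)

text \<open>
  For each \<open>j < i\<close> the functions \<open>\<alpha> i\<close> and \<open>\<alpha> j\<close> differ at some argument \<open>y\<close>, possibly because only one of
  them is defined there. From some stage on, the approximations show this difference for good, and
  then no slot with threshold above \<open>y\<close> is released on account of \<open>j\<close>.
\<close>

lemma ex_follower_\<alpha>:
  assumes "\<And>j. j < i \<Longrightarrow> \<alpha> j \<noteq> \<alpha> i"
  shows "\<exists>t. \<forall>s\<ge>t. follower k (pair 0 i) s = t"
proof -
  have "\<exists>s0. \<forall>s\<ge>s0. \<forall>t\<ge>s. \<forall>r\<ge>s. \<exists>y<t. FA r i y \<noteq> FA r j y" if j: "j < i" for j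
  proof -
    obtain y where y: "\<alpha> j y \<noteq> \<alpha> i y" using assms [OF j] by blast
    obtain r1 r2 where r:
      "\<forall>r\<ge>r1. FA r i y = case_option 0 Suc (\<alpha> i y)"
      "\<forall>r\<ge>r2. FA r j y = case_option 0 Suc (\<alpha> j y)"
      using approximates_limit [OF FA(1)] by meson
    have "FA r i y \<noteq> FA r j y" if "r1 \<le> r" "r2 \<le> r" for r
      using r y that by (auto split: option.splits)
    then show ?thesis
      \<comment> \<open>\<open>Suc y\<close> puts \<open>y\<close> below the threshold, \<open>r1\<close> and \<open>r2\<close> make the difference final\<close>
      by (intro exI [of _ "max (Suc y) (max r1 r2)"]) (force intro: exI [of _ y])
  qed
  then have "\<exists>s0. \<forall>s\<ge>s0. \<forall>j<i. \<forall>t\<ge>s. \<forall>r\<ge>s. \<exists>y<t. FA r i y \<noteq> FA r j y"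
    by (rule common_stage)
  then obtain N where N: "\<forall>j<i. \<forall>t\<ge>N. \<forall>r\<ge>N. \<exists>y<t. FA r i y \<noteq> FA r j y" by blast
  show ?thesis
  proof (rule follower_stabilizes [of N])
    fix t s assume "N \<le> t" "N \<le> s"
    then have "N \<le> pair (pair 0 i) s"
      using le_pair_psnd [of s "pair 0 i"] by simp
    with N \<open>N \<le> t\<close> show "\<not> releases k (pair 0 i) t (pair (pair 0 i) s)"
      by (auto simp: releases_def)
  qed
qed

text \<open>
  Equal functions have eventually equal approximations on the finitely many arguments below the
  threshold, and this releases the slot.
\<close>

lemma follower_\<alpha>_minimal:
  assumes stays: "\<forall>s\<ge>t. follower k (pair 0 i) s = t" and "j < i"
  shows "\<alpha> j \<noteq> \<alpha> i"
proof
  assume eq: "\<alpha> j = \<alpha> i"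
  have "\<exists>r0. \<forall>r\<ge>r0. FA r i y = FA r j y" for y
  proof -
    obtain r1 r2 where
      "\<forall>r\<ge>r1. FA r i y = case_option 0 Suc (\<alpha> i y)"
      "\<forall>r\<ge>r2. FA r j y = case_option 0 Suc (\<alpha> j y)"
      using approximates_limit [OF FA(1)] by meson
    then show ?thesis
      unfolding eq by (intro exI [of _ "max r1 r2"]) simp
  qed
  then have "\<exists>r0. \<forall>r\<ge>r0. \<forall>y<t. FA r i y = FA r j y"
    by (intro common_stage)
  then obtain r0 where r0: "\<forall>r\<ge>r0. \<forall>y<t. FA r i y = FA r j y" by blast
  define s where "s = max t r0"
  have "r0 \<le> pair (pair 0 i) s"
    using le_pair_psnd [of s "pair 0 i"] by (simp add: s_def)
  with r0 \<open>j < i\<close> have "releases k (pair 0 i) t (pair (pair 0 i) s)"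
    by (auto simp: releases_def)
  moreover have "follower k (pair 0 i) s = t"
    using stays by (simp add: s_def)
  ultimately have "follower k (pair 0 i) (Suc s) = Suc s"
    by (simp add: follower_Suc released_def)
  with stays show False by (simp add: s_def)
qed

lemma follower_unique:
  assumes "\<forall>s\<ge>t. follower k d s = t" and "\<forall>s\<ge>t'. follower k d' s = t'" and "\<delta> d = \<delta> d'"
  shows "d = d' \<and> t = t'"
proof -
  have alpha: "d = pair 0 (psnd d)" if "pfst d = 0" for d
    using pair_pfst_psnd [of d] that by simp
  have "pfst d = 0 \<longleftrightarrow> pfst d' = 0"
    using assms(3) disjoint(2) by (auto simp: \<delta>_def split: if_splits)
  then consider "pfst d = 0" "pfst d' = 0" | "pfst d \<noteq> 0" "pfst d' \<noteq> 0"
    by (cases "pfst d = 0") simp_all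
  then have "d = d'"
  proof cases
    case 1
    then have "\<alpha> (psnd d) = \<alpha> (psnd d')"
      using assms(3) by (simp add: \<delta>_def)
    moreover have "\<not> psnd d < psnd d'"
      using follower_\<alpha>_minimal [of t' k "psnd d'" "psnd d"] assms(2) alpha [OF 1(2)] calculation by metis
    moreover have "\<not> psnd d' < psnd d"
      using follower_\<alpha>_minimal [of t k "psnd d" "psnd d'"] assms(1) alpha [OF 1(1)] calculation by metis
    ultimately show ?thesis
      using alpha [OF 1(1)] alpha [OF 1(2)] by (metis linorder_neqE_nat)
  next
    case 2
    then have "\<gamma> (pair (pfst d - 1) (psnd d)) = \<gamma> (pair (pfst d' - 1) (psnd d'))"
      using assms(3) by (simp add: \<delta>_def)
    then have "pair (pfst d - 1) (psnd d) = pair (pfst d' - 1) (psnd d')"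
      by (rule injD [OF inj_\<gamma>])
    with 2 have "pfst d = pfst d'" "psnd d = psnd d'" by auto
    then show ?thesis by (metis pair_pfst_psnd)
  qed
  moreover have "t = t'"
    using assms(1,2) calculation by (metis nat_le_linear)
  ultimately show ?thesis ..
qed

lemma inj_\<nu>: "inj (\<nu> k)"
proof (rule injI)
  fix a a' assume eq: "\<nu> k a = \<nu> k a'"
  have \<delta>_\<beta>: "\<delta> d \<noteq> \<beta> b" for d b
    using \<delta>_in [of d] disjoint by (metis UnE disjoint_iff rangeI)
  have permanent: "\<nu> k a = \<delta> (pfst a)" if "\<forall>s\<ge>psnd a. follower k (pfst a) s = psnd a" for a
    using \<nu>_follower [OF that] by simp
  show "a = a'"
  proof (cases a rule: \<nu>_cases [of _ k])
    case (pooled n)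
    note a = this
    show ?thesis
    proof (cases a' rule: \<nu>_cases [of _ k])
      case (pooled n')
      with a eq have "assigned k n = assigned k n'"
        using inj_\<beta> by (simp add: \<nu>_pooled inj_def)
      then have "n = n'"
        by (rule injD [OF inj_assigned])
      with a pooled show ?thesis by simp
    next
      case follower
      with a eq show ?thesis using permanent \<nu>_pooled \<delta>_\<beta> by metis
    qed
  next
    case follower
    note a = this
    show ?thesis
    proof (cases a' rule: \<nu>_cases [of _ k])
      case (pooled n')
      with a eq show ?thesis using permanent \<nu>_pooled \<delta>_\<beta> by metis
    next
      case follower
      from follower_unique [OF a this] eq permanent [OF a] permanent [OF follower]
      show ?thesis by (metis pair_pfst_psnd)
    qed
  qed
qed

lemma range_\<nu>: "range (\<nu> k) = range \<alpha> \<union> range \<beta> \<union> range \<gamma>"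
proof
  show "range (\<nu> k) \<subseteq> range \<alpha> \<union> range \<beta> \<union> range \<gamma>"
  proof
    fix g assume "g \<in> range (\<nu> k)"
    then obtain a where g: "g = \<nu> k a" by blast
    show "g \<in> range \<alpha> \<union> range \<beta> \<union> range \<gamma>"
    proof (cases a rule: \<nu>_cases [of _ k])
      case (pooled n)
      then show ?thesis by (simp add: g \<nu>_pooled)
    next
      case follower
      then show ?thesis
        using \<nu>_follower [OF follower] \<delta>_in [of "pfst a"] by (auto simp: g)
    qed
  qed
next
  have \<delta>: "\<delta> d \<in> range (\<nu> k)" if "\<exists>t. \<forall>s\<ge>t. follower k d s = t" for d
    using that \<nu>_follower by (metis rangeI)
  have "\<alpha> i \<in> range (\<nu> k)" for i
  proof -
    \<comment> \<open>only the least index of a function keeps a follower\<close>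
    define m where "m = (LEAST j. \<alpha> j = \<alpha> i)"
    have "\<alpha> m = \<alpha> i"
      unfolding m_def by (rule LeastI [of _ i]) simp
    moreover have "\<alpha> j \<noteq> \<alpha> m" if "j < m" for j
      using not_less_Least [of j "\<lambda>j. \<alpha> j = \<alpha> i"] that \<open>\<alpha> m = \<alpha> i\<close> by (simp add: m_def)
    ultimately show ?thesis
      using \<delta> [of "pair 0 m"] ex_follower_\<alpha> [of m] by (simp add: \<delta>_def)
  qed
  moreover have "\<beta> b \<in> range (\<nu> k)" for b
    using surj_assigned [of k] \<nu>_pooled [of k] by (metis rangeI surjD)
  moreover have "\<gamma> c \<in> range (\<nu> k)" for c
    using \<delta> [of "pair (Suc (pfst c)) (psnd c)"] ex_follower_\<gamma> by (simp add: \<delta>_def)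
  ultimately show "range \<alpha> \<union> range \<beta> \<union> range \<gamma> \<subseteq> range (\<nu> k)"
    by auto
qed

section \<open>Incomparability\<close>

text \<open>
  The case distinction is on whether the reduction fixes the first slot of the witness. If it does,
  then the slot is in the pool of the \<open>k\<close>-th numbering only; if it does not, then the slot follows
  the witness in both numberings, and the reduction contradicts injectivity of \<open>\<nu> j\<close>.
\<close>

lemma not_reducible_\<nu>:
  assumes "k \<noteq> j"
  shows "\<not> reducible (\<nu> k) (\<nu> j)"
proof
  assume "reducible (\<nu> k) (\<nu> j)"
  then obtain f p where p: "\<And>x. recf_eval p [x] = Some (f x)" and f: "\<And>a. \<nu> k a = \<nu> j (f a)"
    unfolding reducible_def computable_iff by (metis comp_apply)
  define d where "d = pair (Suc k) (recf_code p)"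
  define a where "a = pair d 0"
  have zero: "(\<And>n. \<not> releases i d 0 n) \<Longrightarrow> \<nu> i a = \<delta> d" for i
  proof -
    assume "\<And>n. \<not> releases i d 0 n"
    then have "follower i d s = 0" for s
      by (induction s) (simp_all add: follower_Suc released_def)
    then show "\<nu> i a = \<delta> d"
      unfolding a_def by (intro \<nu>_follower) simp
  qed
  have "\<not> releases j d 0 n" for n
    using assms by (simp add: releases_def d_def)
  then have j: "\<nu> j a = \<delta> d"
    by (rule zero)
  have k: "releases k d 0 n \<longleftrightarrow> value_within n (recf_code p) (list_code [a]) = Suc a" for n
    by (simp add: releases_def d_def a_def)
  show False
  proof (cases "f a = a")
    case True
    then obtain s where s: "value_within s (recf_code p) (list_code [a]) = Suc a"
      using p [of a] unfolding recf_eval_iff_value_within by auto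
    have "\<not> (\<forall>r\<ge>0. follower k d r = 0)"
    proof
      assume stays: "\<forall>r\<ge>0. follower k d r = 0"
      have "released k (pair d s)"
        using value_within_mono [OF s le_pair_psnd [of s d]] stays by (simp add: released_def k)
      with stays show False
        using follower_Suc [of k d s] by simp
    qed
    then obtain n where "pooled k n = a"
      using never_pooled_iff [of k d 0] by (auto simp: a_def)
    then have "\<nu> k a \<in> range \<beta>"
      using \<nu>_pooled by (metis rangeI)
    moreover have "\<nu> k a \<in> range \<gamma>"
      using f [of a] True j by (simp add: \<delta>_def d_def)
    ultimately show False using disjoint(3) by blast
  next
    case False
    have "\<not> releases k d 0 n" for n
      using False p [of a] recf_eval_iff_value_within [of p "[a]" a] by (auto simp: k)
    then have "\<nu> j (f a) = \<nu> j a"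
      using zero [of k] j f [of a] by simp
    with inj_\<nu> [of j] False show False by (simp add: inj_def)
  qed
qed

section \<open>Uniform computability of the numberings\<close>

lemma computable_FD:
  assumes "computable f" and "computable g" and "computable h"
  shows "computable (\<lambda>x. FD (f x) (g x) (h x))"
  unfolding FD_def by (intro computable_intros computable3D [OF FA(2)] computable3D [OF FC(2)] assms)

lemma decidable_releases:
  assumes "computable f" and "computable g" and "computable h" and "computable l"
  shows "decidable (\<lambda>x. releases (f x) (g x) (h x) (l x))"
  unfolding decidable_def
  by (rule computable_compose4 [where h = "\<lambda>k d t n. of_bool (releases k d t n)",
        OF _ assms], fold decidable_def, unfold releases_def list_code.simps)
    (intro computable_intros computable3D [OF FA(2)] computable_value_within)

lemma computable_follower:
  assumes "computable f" and "computable g" and "computable h"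
  shows "computable (\<lambda>x. follower (f x) (g x) (h x))"
  by (rule computable_compose3 [where h = follower, OF _ assms], unfold follower_def)
    (intro computable_intros decidable_releases)

lemma decidable_released:
  assumes "computable f" and "computable g"
  shows "decidable (\<lambda>x. released (f x) (g x))"
  unfolding released_def by (intro computable_intros decidable_releases computable_follower assms)

lemma computable_pooled:
  assumes "computable f" and "computable g"
  shows "computable (\<lambda>x. pooled (f x) (g x))"
  unfolding pooled_def by (intro computable_intros decidable_released computable_follower assms)

lemma computable_history_entry:
  assumes "computable f" and "computable g"
  shows "computable (\<lambda>x. history_entry (f x) (g x))"
  unfolding history_entry_def by (intro computable_intros assms)

lemma decidable_candidate:
  assumes "computable f" and "computable g" and "computable h" and "computable l"
  shows "decidable (\<lambda>x. candidate (f x) (g x) (h x) (l x))"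
  unfolding decidable_def
  by (rule computable_compose4 [where h = "\<lambda>k n U z. of_bool (candidate k n U z)",
        OF _ assms], fold decidable_def, unfold candidate_def)
    (intro computable_intros computable_history_entry computable_FD computable3D [OF FB(2)] decidable_released)

lemma computable_least_candidate:
  assumes "computable f" and "computable g" and "computable h"
  shows "computable (\<lambda>x. least_candidate (f x) (g x) (h x))"
  by (rule computable_compose3 [where h = least_candidate, OF _ assms], unfold least_candidate_def)
    (intro computable_Least ex_candidate computable_intros decidable_candidate)

lemma computable_assigned:
  assumes "computable f" and "computable g"
  shows "computable (\<lambda>x. assigned (f x) (g x))"
  by (rule computable_compose2 [where h = assigned, OF _ assms], unfold assigned_def history_def)
    (intro computable_intros computable_least_candidate)

lemma computable_stage_value:
  "computable (\<lambda>z. stage_value (pfst z) (pfst (psnd z)) (pfst (psnd (psnd z))) (psnd (psnd (psnd z))))"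
  unfolding stage_value_def
  by (intro computable_intros computable_pooled computable_assigned computable_follower computable_FD
      computable3D [OF FB(2)])

lemma uniformly_ce_\<nu>: "uniformly_ce \<nu>"
  using partial_computable3_search [where W = stage_value, OF computable_stage_value]
  unfolding uniformly_ce_def \<nu>_def [abs_def] .

end

theorem corollary6:
  fixes A B C :: "(nat \<rightharpoonup> nat) set"
  assumes "A \<subseteq> P1" and "B \<subseteq> P1" and "C \<subseteq> P1"
    and "A \<inter> B = {}" and "A \<inter> C = {}" and "B \<inter> C = {}"
    and "\<exists>\<alpha>. computable_numbering \<alpha> A"
    and "\<exists>\<beta>. friedberg_numbering \<beta> B"
    and "\<exists>\<gamma>. friedberg_numbering \<gamma> C"
    and "strongly_dense_in B (A \<union> C)"
  shows "\<exists>\<nu> :: nat \<Rightarrow> nat \<Rightarrow> (nat \<rightharpoonup> nat).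
           uniformly_ce \<nu> \<and>
           (\<forall>i. friedberg_numbering (\<nu> i) (A \<union> B \<union> C)) \<and>
           pairwise_incomparable \<nu>"
proof -
  obtain \<alpha> \<beta> \<gamma> where \<alpha>: "range \<alpha> = A" "partial_computable2 \<alpha>"
    and \<beta>: "range \<beta> = B" "partial_computable2 \<beta>" "inj \<beta>"
    and \<gamma>: "range \<gamma> = C" "partial_computable2 \<gamma>" "inj \<gamma>"
    using assms(7-9)
    unfolding friedberg_numbering_def computable_numbering_def numbering_def by blast
  obtain FA FB FC where F: "approximates FA \<alpha>" "computable3 FA"
    "approximates FB \<beta>" "computable3 FB" "approximates FC \<gamma>" "computable3 FC"
    using \<alpha>(2) \<beta>(2) \<gamma>(2) ex_approximates by meson
  interpret friedberg_construction \<alpha> \<beta> \<gamma> FA FB FC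
    using assms(4-6,10) F \<alpha>(1) \<beta>(1,3) \<gamma>(1,3) by unfold_locales simp_all
  have "friedberg_numbering (\<nu> i) (A \<union> B \<union> C)" for i
    unfolding friedberg_numbering_def computable_numbering_def numbering_def
    using range_\<nu> [of i] inj_\<nu> [of i] \<alpha>(1) \<beta>(1) \<gamma>(1)
      partial_computable3_section [OF uniformly_ce_\<nu> [unfolded uniformly_ce_def]] by simp
  moreover have "pairwise_incomparable \<nu>"
    unfolding pairwise_incomparable_def incomparable_def by (auto simp: not_reducible_\<nu>)
  ultimately show ?thesis
    using uniformly_ce_\<nu> by blast
qed

end
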